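(* Let $M(d,2)$ be the number of pairwise nonequivalent $d$-dimensional extremal $(0,1)$-matrices of order $2$. Then $\log_2 M(d,2)=d^2(1+o(1))$ as $d\to\infty$.
   Context: A $d$-dimensional $(0,1)$-matrix of order $2$ is an array $(a_\alpha)_{\alpha\in\{0,1\}^d}$ with $a_\alpha\in\{0,1\}$; its support is the set of $\alpha$ with $a_\alpha=1$. The hyperplane $\Gamma_{i,j}$ of direction $i$ is $\{\alpha:\alpha_i=j\}$, $1\le i\le d$, $j\in\{0,1\}$; hyperplanes of the same direction are parallel. Two matrices are equivalent if one can be turned into the other by permutations of parallel hyperplanes (independently in each direction) and permutations of the directions (transpositions). The number of nonequivalent matrices means the number of equivalence classes. A polydiagonal in a matrix $A$ is an assignment of nonnegative real weights to the entries of the support of $A$ such that the sum of the weights over each hyperplane equals $1$. The matrix $A$ is extremal if $A$ has no polydiagonal, and after adding any new index to the support of $A$ the resulting matrix has a polydiagonal. *)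

theory Defs
  imports "HOL-Combinatorics.Permutations" "HOL-Library.Landau_Symbols" "HOL-Library.FuncSet"
    Complex_Main
begin

text \<open>
  Indices and matrices are extensional functions, so that they are in bijection with
  \<open>{0,1}\<^sup>d\<close> and with the \<open>(0,1)\<close>-arrays over it, and cardinalities are meaningful.
\<close>

definition idx :: "nat \<Rightarrow> (nat \<Rightarrow> nat) set" where
  "idx d = {1..d} \<rightarrow>\<^sub>E {0, 1}"

definition matrices :: "nat \<Rightarrow> ((nat \<Rightarrow> nat) \<Rightarrow> nat) set" where
  "matrices d = idx d \<rightarrow>\<^sub>E {0, 1}"

definition support :: "nat \<Rightarrow> ((nat \<Rightarrow> nat) \<Rightarrow> nat) \<Rightarrow> (nat \<Rightarrow> nat) set" where
  "support d A = {\<alpha> \<in> idx d. A \<alpha> = 1}"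

definition hyperplane :: "nat \<Rightarrow> nat \<Rightarrow> nat \<Rightarrow> (nat \<Rightarrow> nat) set" where
  "hyperplane d i j = {\<alpha> \<in> idx d. \<alpha> i = j}"

definition polydiagonal ::
    "nat \<Rightarrow> ((nat \<Rightarrow> nat) \<Rightarrow> nat) \<Rightarrow> ((nat \<Rightarrow> nat) \<Rightarrow> real) \<Rightarrow> bool" where
  "polydiagonal d A w \<longleftrightarrow>
     (\<forall>\<alpha> \<in> support d A. w \<alpha> \<ge> 0) \<and>
     (\<forall>i \<in> {1..d}. \<forall>j \<in> {0, 1}. (\<Sum>\<alpha> \<in> support d A \<inter> hyperplane d i j. w \<alpha>) = 1)"

definition extremal :: "nat \<Rightarrow> ((nat \<Rightarrow> nat) \<Rightarrow> nat) \<Rightarrow> bool" where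
  "extremal d A \<longleftrightarrow>
     A \<in> matrices d \<and>
     (\<nexists>w. polydiagonal d A w) \<and>
     (\<forall>\<alpha> \<in> idx d - support d A. \<exists>w. polydiagonal d (A(\<alpha> := 1)) w)"

text \<open>
  Permutations \<open>\<sigma> i\<close> of the two hyperplanes of each direction \<open>i\<close>, combined with a permutation
  \<open>\<pi>\<close> of the directions. These combined maps are closed under composition and inverses, so one of
  them accounts for any sequence of the two kinds of operations.
\<close>

definition permute_index ::
    "nat \<Rightarrow> (nat \<Rightarrow> nat \<Rightarrow> nat) \<Rightarrow> (nat \<Rightarrow> nat) \<Rightarrow> (nat \<Rightarrow> nat) \<Rightarrow> (nat \<Rightarrow> nat)" where
  "permute_index d \<sigma> \<pi> \<alpha> = (\<lambda>i \<in> {1..d}. \<sigma> i (\<alpha> (\<pi> i)))"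

definition equivalent ::
    "nat \<Rightarrow> (((nat \<Rightarrow> nat) \<Rightarrow> nat) \<times> ((nat \<Rightarrow> nat) \<Rightarrow> nat)) set" where
  "equivalent d = {(A, B). A \<in> matrices d \<and> B \<in> matrices d \<and>
     (\<exists>\<sigma> \<pi>. (\<forall>i \<in> {1..d}. \<sigma> i permutes {0, 1}) \<and> \<pi> permutes {1..d} \<and>
        (\<forall>\<alpha> \<in> idx d. B \<alpha> = A (permute_index d \<sigma> \<pi> \<alpha>)))}"

definition num_extremal :: "nat \<Rightarrow> nat" where
  "num_extremal d = card ({A. extremal d A} // equivalent d)"

end

theory Submission
  imports Defs "HOL-Real_Asymp.Real_Asymp"
begin

text \<open>
  Writing \<open>x = (-1)\<^sup>\<alpha>\<close>, a matrix has a polydiagonal iff the origin is a convex combination of its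
  support, so open halfspaces with no cube vertex on the boundary give extremal matrices, and every
  extremal support contains exactly one of any two antipodal vertices. Each class has at most
  \<open>2\<^sup>d d!\<close> members, which is negligible, so it suffices to count extremal matrices.

  Upper bound: a family has at most as many members as it shatters sets, and the sets shattered by
  extremal supports are linearly independent.

  Lower bound: a family has at least as many members as it strongly shatters sets. A set \<open>C\<close> of
  vertices is strongly shattered by halfspaces if no linear combination of \<open>C\<close> with at least two
  nonzero coefficients is a \<open>\<plusminus>1\<close> vector. By the argument of Odlyzko, for every \<open>\<delta> > 0\<close> at least half of
  all tuples of \<open>(1 - \<delta>) d\<close> vertices have this property for large \<open>d\<close>: a combination with \<open>j\<close> nonzero
  coefficients may be recovered from \<open>j\<close> coordinates, and by the Littlewood--Offord inequality each of the
  other coordinates takes a value \<open>\<plusminus>1\<close> with probability at most \<open>min (3/4) (2 / sqrt (j + 1))\<close>.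
\<close>

section \<open>Shattering and linear algebra\<close>

text \<open>Why shattered sets are independent: given a linear relation on a shattered set, take the
  support whose trace is the set of vertices with positive coefficient. It contains the antipodes of
  those with negative coefficient, and replacing these by their antipodes makes all coefficients
  nonnegative, which yields a polydiagonal. Why generic sets are strongly shattered: some hyperplane
  through the origin contains such a set and no other vertex of the facet. A slight tilt puts the
  points of the set on prescribed sides and moves no other vertex across, so all patterns share one
  fixed part. Why \<open>(1 - \<delta>) d\<close> and not \<open>d\<close>: the union bound pays an
  exponential factor for the choice of the nonzero coefficients, of the \<open>j\<close> coordinates
  and of the signs there, so linearly many coordinates must remain to repay it. For bounded
  \<open>j\<close> the price is polynomial and any constant below 1 repays it; \<open>3/4\<close> is
  there because \<open>2 / sqrt (j + 1)\<close> is at least 1 for \<open>j \<le> 3\<close>. Passing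
  from tuples to sets costs \<open>k ^ k\<close>, which is negligible like the size of the classes.
  Only the final limit lets \<open>\<delta>\<close> tend to 0.\<close>

definition shatters :: "'a set set \<Rightarrow> 'a set \<Rightarrow> bool" where
  "shatters F C \<longleftrightarrow> (\<forall>D\<subseteq>C. \<exists>S\<in>F. S \<inter> C = D)"

text \<open>Pajor's form of the Sauer-Shelah lemma. Split \<open>F\<close> by membership of
  \<open>x\<close>: a set shattered by one half is shattered by \<open>F\<close>, and a set
  \<open>C\<close> shattered by both halves also makes \<open>insert x C\<close> shattered, so it is
  counted twice, as the sum of the two cardinalities requires.\<close>

lemma card_le_card_shattered:
  assumes "finite X" "F \<subseteq> Pow X"
  shows "card F \<le> card {C. C \<subseteq> X \<and> shatters F C}"
  using assms
proof (induction X arbitrary: F rule: finite_induct)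
  case empty
  then consider "F = {}" | "F = {{}}" by auto
  then show ?case
  proof cases
    case 2
    then have "{C. C \<subseteq> {} \<and> shatters F C} = {{}}" by (auto simp: shatters_def)
    then show ?thesis using 2 by simp
  qed simp
next
  case (insert x X)
  define F0 where "F0 = {S\<in>F. x \<notin> S}"
  define F1 where "F1 = (\<lambda>S. S - {x}) ` {S\<in>F. x \<in> S}"
  define h where "h G = {C. C \<subseteq> X \<and> shatters G C}" for G :: "'a set set"
  have fin: "finite F" using insert by (meson finite_Pow_iff finite_insert finite_subset)
  have inj: "inj_on (\<lambda>S. S - {x}) {S\<in>F. x \<in> S}" by (auto simp: inj_on_def)
  have fh: "finite (h G)" for G unfolding h_def using insert by simp
  have mem0: "S \<in> F" if "S \<in> F0" for S using that by (auto simp: F0_def)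
  have mem1: "insert x S \<in> F" if "S \<in> F1" for S using that by (auto simp: F1_def insert_absorb)
  have "F0 \<union> {S\<in>F. x \<in> S} = F" by (auto simp: F0_def)
  then have "card F = card F0 + card {S\<in>F. x \<in> S}"
    using card_Un_disjoint[of F0 "{S\<in>F. x \<in> S}"] fin by (auto simp: F0_def)
  also have "card {S\<in>F. x \<in> S} = card F1" unfolding F1_def using inj by (simp add: card_image)
  also have "card F0 \<le> card (h F0)" unfolding h_def
    by (rule insert.IH) (use insert.prems in \<open>auto simp: F0_def\<close>)
  also have "card F1 \<le> card (h F1)" unfolding h_def
    by (rule insert.IH) (use insert.prems in \<open>auto simp: F1_def\<close>)
  also have "card (h F0) + card (h F1) = card (h F0 \<union> h F1) + card (h F0 \<inter> h F1)"
    by (rule card_Un_Int[OF fh fh])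
  also have "card (h F0 \<inter> h F1) = card (insert x ` (h F0 \<inter> h F1))"
    by (rule card_image[symmetric]) (use insert.hyps in \<open>auto simp: inj_on_def h_def\<close>)
  also have "card (h F0 \<union> h F1) + \<dots> = card ((h F0 \<union> h F1) \<union> insert x ` (h F0 \<inter> h F1))"
    by (rule card_Un_disjoint[symmetric]) (use fh insert.hyps in \<open>auto simp: h_def[abs_def]\<close>)
  also have "\<dots> \<le> card {C. C \<subseteq> insert x X \<and> shatters F C}"
  proof (rule card_mono)
    show "finite {C. C \<subseteq> insert x X \<and> shatters F C}" using insert by simp
    have a: "shatters F C" if "C \<in> h F0" for C
      using that mem0 unfolding h_def shatters_def by blast
    have b: "shatters F C" if C: "C \<in> h F1" for C
    proof -
      have "x \<notin> C" using C insert.hyps by (auto simp: h_def)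
      then have eq: "insert x S \<inter> C = S \<inter> C" for S by blast
      show ?thesis unfolding shatters_def
      proof (intro allI impI)
        fix D assume "D \<subseteq> C"
        then obtain S where "S \<in> F1" "S \<inter> C = D" using C unfolding h_def shatters_def by blast
        then show "\<exists>S\<in>F. S \<inter> C = D" using eq mem1 by (intro bexI[of _ "insert x S"]) auto
      qed
    qed
    have c: "shatters F (insert x C)" if C: "C \<in> h F0" "C \<in> h F1" for C
      unfolding shatters_def
    proof (intro allI impI)
      fix D assume D: "D \<subseteq> insert x C"
      have xC: "x \<notin> C" using C insert.hyps by (auto simp: h_def)
      show "\<exists>S\<in>F. S \<inter> insert x C = D"
      proof (cases "x \<in> D")
        case True
        have "D - {x} \<subseteq> C" using D by blast
        then obtain S where "S \<in> F1" "S \<inter> C = D - {x}"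
          using C(2) unfolding h_def shatters_def by blast
        then have "insert x S \<inter> insert x C = D" "insert x S \<in> F" using True D xC mem1 by blast+
        then show ?thesis by blast
      next
        case False
        then have "D \<subseteq> C" using D by blast
        then obtain S where "S \<in> F0" "S \<inter> C = D"
          using C(1) unfolding h_def shatters_def by blast
        then have "S \<inter> insert x C = D" "S \<in> F" by (auto simp: F0_def)
        then show ?thesis by blast
      qed
    qed
    show "h F0 \<union> h F1 \<union> insert x ` (h F0 \<inter> h F1) \<subseteq> {C. C \<subseteq> insert x X \<and> shatters F C}"
      using a b c by (auto simp: h_def)
  qed
  finally show ?case by simp
qed

text \<open>\<open>F\<close> contains a whole subcube in the directions of \<open>C\<close>: unlike
  in plain shattering, the part \<open>B\<close> outside \<open>C\<close> must be the same for all
  \<open>D\<close>.\<close>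

definition strongly_shatters :: "'a set \<Rightarrow> 'a set set \<Rightarrow> 'a set \<Rightarrow> bool" where
  "strongly_shatters X F C \<longleftrightarrow> (\<exists>B\<subseteq>X - C. \<forall>D\<subseteq>C. B \<union> D \<in> F)"

text \<open>\<open>C\<close> is strongly shattered by \<open>F\<close> iff \<open>X - C\<close> is not shattered by the complement of \<open>F\<close>.\<close>

lemma card_strongly_shattered_le:
  assumes "finite X" "F \<subseteq> Pow X"
  shows "card {C. C \<subseteq> X \<and> strongly_shatters X F C} \<le> card F"
proof -
  define Q where "Q = {C. C \<subseteq> X \<and> shatters (Pow X - F) C}"
  define P where "P = {C. C \<subseteq> X \<and> strongly_shatters X F C}"
  have "(\<lambda>C. X - C) ` P \<subseteq> Pow X - Q"
  proof -
    have "\<not> shatters (Pow X - F) (X - C)" if C: "C \<subseteq> X" "strongly_shatters X F C" for C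
    proof
      assume sh: "shatters (Pow X - F) (X - C)"
      obtain B where B: "B \<subseteq> X - C" "\<forall>D\<subseteq>C. B \<union> D \<in> F"
        using C unfolding strongly_shatters_def by blast
      obtain S where S: "S \<in> Pow X - F" "S \<inter> (X - C) = B" using sh B unfolding shatters_def by blast
      have "S = B \<union> (S \<inter> C)" using S C by auto
      then show False using B S by (metis DiffD2 inf_le2)
    qed
    then show ?thesis by (auto simp: P_def Q_def)
  qed
  moreover have "inj_on (\<lambda>C. X - C) P" by (auto simp: inj_on_def P_def)
  ultimately have "card P \<le> card (Pow X - Q)"
    using assms by (metis card_image card_mono finite_Diff finite_Pow_iff)
  also have "\<dots> = card (Pow X) - card Q"
    by (rule card_Diff_subset) (use assms in \<open>auto simp: Q_def\<close>)
  finally have 1: "card P \<le> card (Pow X) - card Q" .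
  \<comment> \<open>The lower bound on \<open>F\<close> is the upper bound for its complement, read
    backwards.\<close>
  have 2: "card (Pow X - F) \<le> card Q" unfolding Q_def
    by (rule card_le_card_shattered) (use assms in auto)
  have "card (Pow X - F) = card (Pow X) - card F"
    by (rule card_Diff_subset) (use assms in \<open>auto intro: finite_subset\<close>)
  then show ?thesis using 1 2 unfolding P_def by linarith
qed

section \<open>Linear algebra for finite families of real functions\<close>

text \<open>Gaussian elimination, one coordinate of \<open>I\<close> at a time: each coordinate
  contributes at most one pivot vector. It serves both to find relations among vertices and to
  select coordinates that span all others.\<close>

lemma spanning_subfamily:
  fixes v :: "'t \<Rightarrow> 'i \<Rightarrow> real"
  assumes "finite I" "finite T"
  shows "\<exists>R\<subseteq>T. card R \<le> card I \<and> (\<forall>t\<in>T. \<exists>c. \<forall>i\<in>I. v t i = (\<Sum>s\<in>R. c s * v s i))"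
  using assms(1)
proof (induction I arbitrary: v rule: finite_induct)
  case empty
  then show ?case by (intro exI[of _ "{}"]) auto
next
  case (insert a I)
  show ?case
  proof (cases "\<forall>t\<in>T. v t a = 0")
    case True
    obtain R where R: "R \<subseteq> T" "card R \<le> card I"
      "\<forall>t\<in>T. \<exists>c. \<forall>i\<in>I. v t i = (\<Sum>s\<in>R. c s * v s i)" using insert.IH[of v] by auto
    have "(\<Sum>s\<in>R. c s * v s a) = 0" for c using True R(1) by (intro sum.neutral) auto
    then have "\<forall>t\<in>T. \<exists>c. \<forall>i\<in>insert a I. v t i = (\<Sum>s\<in>R. c s * v s i)" using True R(3) by auto
    moreover have "card R \<le> card (insert a I)" using R(2) insert.hyps by simp
    ultimately show ?thesis using R(1) by blast
  next
    case False
    then obtain t0 where t0: "t0 \<in> T" "v t0 a \<noteq> 0" by auto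
    define k where "k t = v t a / v t0 a" for t
    define w where "w t i = v t i - k t * v t0 i" for t i
    have wa: "w t a = 0" for t using t0 by (simp add: w_def k_def)
    have w0: "w t0 i = 0" for i using t0 by (simp add: w_def k_def)
    obtain R where R: "R \<subseteq> T" "card R \<le> card I"
      "\<forall>t\<in>T. \<exists>c. \<forall>i\<in>I. w t i = (\<Sum>s\<in>R. c s * w s i)" using insert.IH[of w] by auto
    have fR: "finite R" using R(1) assms(2) by (rule finite_subset)
    define R' where "R' = R - {t0}"
    have "\<exists>c. \<forall>i\<in>insert a I. v t i = (\<Sum>s\<in>insert t0 R'. c s * v s i)" if tT: "t \<in> T" for t
    proof -
      obtain c where c: "\<forall>i\<in>I. w t i = (\<Sum>s\<in>R. c s * w s i)"
        using bspec[OF R(3) tT] by (elim exE)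
      \<comment> \<open>The coefficient of the pivot collects the multiples of \<open>v t0\<close>
        that elimination removed from \<open>v t\<close> and from the members of
        \<open>R'\<close>.\<close>
      define c' where "c' s = (if s = t0 then k t - (\<Sum>s\<in>R'. c s * k s) else c s)" for s
      have "v t i = (\<Sum>s\<in>insert t0 R'. c' s * v s i)" if "i \<in> insert a I" for i
      proof -
        have "w t i = (\<Sum>s\<in>R. c s * w s i)" 
        proof (cases "i = a")
          case False
          then have "i \<in> I" using that by simp
          then show ?thesis by (rule c[rule_format])
        qed (simp add: wa)
        also have "\<dots> = (\<Sum>s\<in>R'. c s * w s i)"
          unfolding R'_def by (rule sum.mono_neutral_right) (use fR w0 in auto)
        also have "\<dots> = (\<Sum>s\<in>R'. c s * v s i) - (\<Sum>s\<in>R'. c s * k s) * v t0 i"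
          by (simp add: w_def algebra_simps sum_subtractf sum_distrib_left)
        also have "(\<Sum>s\<in>R'. c s * v s i) = (\<Sum>s\<in>R'. c' s * v s i)"
          by (rule sum.cong) (auto simp: c'_def R'_def)
        finally have "w t i = (\<Sum>s\<in>R'. c' s * v s i) - (\<Sum>s\<in>R'. c s * k s) * v t0 i" .
        moreover have "c' t0 = k t - (\<Sum>s\<in>R'. c s * k s)" by (simp add: c'_def)
        ultimately have "v t i = (\<Sum>s\<in>R'. c' s * v s i) + c' t0 * v t0 i"
          unfolding w_def by (simp add: left_diff_distrib)
        also have "\<dots> = (\<Sum>s\<in>insert t0 R'. c' s * v s i)"
          using fR by (subst sum.insert) (auto simp: R'_def)
        finally show ?thesis .
      qed
      then show ?thesis by (intro exI[of _ c'] ballI)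
    qed
    moreover have "insert t0 R' \<subseteq> T" using t0 R(1) by (auto simp: R'_def)
    moreover have "card (insert t0 R') \<le> card (insert a I)"
    proof -
      have "card (insert t0 R') \<le> Suc (card R')" using fR by (subst card_insert_disjoint) (auto simp: R'_def)
      also have "card R' \<le> card R" unfolding R'_def by (rule card_Diff1_le)
      finally show ?thesis using R(2) insert.hyps by simp
    qed
    ultimately show ?thesis by blast
  qed
qed

text \<open>The Fredholm alternative. A new vector \<open>r\<close> either depends on
  \<open>R\<close> and changes nothing, or there is a functional \<open>m\<close> that kills
  \<open>R\<close> and is 1 at \<open>r\<close>, by which everything can be reduced modulo
  \<open>r\<close>.\<close>

lemma combination_or_dual_vector:
  fixes v :: "'t \<Rightarrow> 'i \<Rightarrow> real" and y :: "'i \<Rightarrow> real"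
  assumes "finite I" "finite R"
  shows "(\<exists>c. \<forall>i\<in>I. y i = (\<Sum>s\<in>R. c s * v s i)) \<or>
    (\<exists>l. (\<forall>s\<in>R. (\<Sum>i\<in>I. l i * v s i) = 0) \<and> (\<Sum>i\<in>I. l i * y i) = 1)"
  using assms(2)
proof (induction R arbitrary: y rule: finite_induct)
  case empty
  show ?case
  proof (cases "\<exists>i\<in>I. y i \<noteq> 0")
    case True
    then obtain i where i: "i \<in> I" "y i \<noteq> 0" by blast
    have "(\<Sum>j\<in>I. (if j = i then 1 / y i else 0) * y j) =
        (\<Sum>j\<in>I. if j = i then 1 else 0)" using i by (intro sum.cong) auto
    then have "(\<Sum>j\<in>I. (if j = i then 1 / y i else 0) * y j) = 1" using i assms(1) by simp
    then show ?thesis by (intro disjI2 exI[of _ "\<lambda>j. if j = i then 1 / y i else 0"]) simp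
  next
    case False
    then show ?thesis by simp
  qed
next
  case (insert r R)
  show ?case
  proof (cases "\<exists>c. \<forall>i\<in>I. v r i = (\<Sum>s\<in>R. c s * v s i)")
    case True
    then obtain c where c: "\<forall>i\<in>I. v r i = (\<Sum>s\<in>R. c s * v s i)" by blast
    from insert.IH[of y] show ?thesis
    proof
      assume "\<exists>c. \<forall>i\<in>I. y i = (\<Sum>s\<in>R. c s * v s i)"
      then obtain e where e: "\<forall>i\<in>I. y i = (\<Sum>s\<in>R. e s * v s i)" by blast
      have "(\<Sum>s\<in>R. (if s = r then 0 else e s) * v s i) = (\<Sum>s\<in>R. e s * v s i)" for i
        using insert.hyps by (intro sum.cong) auto
      then have "\<forall>i\<in>I. y i = (\<Sum>s\<in>insert r R. (if s = r then 0 else e s) * v s i)"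
        using e insert.hyps by simp
      then show ?thesis by (intro disjI1 exI[of _ "\<lambda>s. if s = r then 0 else e s"])
    next
      assume "\<exists>l. (\<forall>s\<in>R. (\<Sum>i\<in>I. l i * v s i) = 0) \<and> (\<Sum>i\<in>I. l i * y i) = 1"
      then obtain l where l: "\<forall>s\<in>R. (\<Sum>i\<in>I. l i * v s i) = 0" "(\<Sum>i\<in>I. l i * y i) = 1" by blast
      have "(\<Sum>i\<in>I. l i * v r i) = (\<Sum>i\<in>I. \<Sum>s\<in>R. c s * (l i * v s i))"
      proof (rule sum.cong[OF refl])
        fix i assume "i \<in> I"
        then have "l i * v r i = l i * (\<Sum>s\<in>R. c s * v s i)" using c by (metis (no_types))
        then show "l i * v r i = (\<Sum>s\<in>R. c s * (l i * v s i))"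
          by (simp add: sum_distrib_left mult.left_commute)
      qed
      also have "\<dots> = (\<Sum>s\<in>R. c s * (\<Sum>i\<in>I. l i * v s i))"
        by (subst sum.swap) (simp add: sum_distrib_left)
      also have "\<dots> = 0" using l by simp
      finally show ?thesis using l by auto
    qed
  next
    case False
    then have "\<exists>l. (\<forall>s\<in>R. (\<Sum>i\<in>I. l i * v s i) = 0) \<and> (\<Sum>i\<in>I. l i * v r i) = 1"
      using insert.IH[of "v r"] by argo
    then obtain m where m: "\<forall>s\<in>R. (\<Sum>i\<in>I. m i * v s i) = 0" "(\<Sum>i\<in>I. m i * v r i) = 1"
      by (elim exE conjE)
    \<comment> \<open>With this \<open>b\<close> the functional \<open>m\<close> vanishes at
      \<open>y - b * v r\<close>. Subtracting \<open>a * m\<close> from \<open>l\<close> therefore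
      makes it vanish at \<open>r\<close> without losing the value 1.\<close>
    define b where "b = (\<Sum>i\<in>I. m i * y i)"
    from insert.IH[of "\<lambda>i. y i - b * v r i"] show ?thesis
    proof
      assume "\<exists>c. \<forall>i\<in>I. y i - b * v r i = (\<Sum>s\<in>R. c s * v s i)"
      then obtain e where e: "\<forall>i\<in>I. y i - b * v r i = (\<Sum>s\<in>R. e s * v s i)" by blast
      have "(\<Sum>s\<in>R. (if s = r then b else e s) * v s i) = (\<Sum>s\<in>R. e s * v s i)" for i
        using insert.hyps by (intro sum.cong) auto
      then have "\<forall>i\<in>I. y i = (\<Sum>s\<in>insert r R. (if s = r then b else e s) * v s i)"
        using e insert.hyps by (simp add: algebra_simps)
      then show ?thesis by (intro disjI1 exI[of _ "\<lambda>s. if s = r then b else e s"])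
    next
      assume "\<exists>l. (\<forall>s\<in>R. (\<Sum>i\<in>I. l i * v s i) = 0) \<and> (\<Sum>i\<in>I. l i * (y i - b * v r i)) = 1"
      then obtain l where l: "\<forall>s\<in>R. (\<Sum>i\<in>I. l i * v s i) = 0"
        "(\<Sum>i\<in>I. l i * (y i - b * v r i)) = 1" by blast
      define a where "a = (\<Sum>i\<in>I. l i * v r i)"
      have ip: "(\<Sum>i\<in>I. (l i - a * m i) * z i) = (\<Sum>i\<in>I. l i * z i) - a * (\<Sum>i\<in>I. m i * z i)" for z
        by (simp add: algebra_simps sum_subtractf sum_distrib_left)
      have "(\<Sum>i\<in>I. l i * y i) - b * a = 1"
        using l(2) by (simp add: a_def algebra_simps sum_subtractf sum_distrib_left)
      then have "(\<Sum>i\<in>I. (l i - a * m i) * y i) = 1" unfolding ip b_def[symmetric] by (simp add: algebra_simps)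
      moreover have "\<forall>s\<in>insert r R. (\<Sum>i\<in>I. (l i - a * m i) * v s i) = 0"
        unfolding ip using l m by (auto simp: a_def[symmetric])
      ultimately show ?thesis by (intro disjI2 exI[of _ "\<lambda>i. l i - a * m i"]) blast
    qed
  qed
qed

section \<open>Antichains and the Littlewood--Offord inequality\<close>

text \<open>The LYM inequality, by averaging the induction hypothesis over all deletions of one point.\<close>

lemma sum_inverse_binomial_antichain_le_1:
  assumes "finite X" "F \<subseteq> Pow X" "\<And>A B. A \<in> F \<Longrightarrow> B \<in> F \<Longrightarrow> A \<subseteq> B \<Longrightarrow> A = B"
  shows "(\<Sum>A\<in>F. 1 / real (card X choose card A)) \<le> 1"
  using assms
proof (induction "card X" arbitrary: X F)
  case 0
  then have "F = {} \<or> F = {{}}" by auto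
  then show ?case using 0 by auto
next
  case (Suc n)
  show ?case
  proof (cases "X \<in> F")
    case True
    have "F = {X}" using Suc.prems(2) Suc.prems(3)[OF _ True] True by blast
    then show ?thesis by simp
  next
    case False
    have finF: "finite F" using Suc.prems by (meson finite_Pow_iff finite_subset)
    have IH: "(\<Sum>A\<in>{A\<in>F. x \<notin> A}. 1 / real (n choose card A)) \<le> 1" if x: "x \<in> X" for x
    proof -
      have c: "card (X - {x}) = n" using Suc.hyps(2) Suc.prems(1) x by simp
      have "(\<Sum>A\<in>{A\<in>F. x \<notin> A}. 1 / real (card (X - {x}) choose card A)) \<le> 1"
        by (rule Suc.hyps(1)) (use Suc.prems c in auto)
      then show ?thesis unfolding c .
    qed
    have "real (Suc n) * (\<Sum>A\<in>F. 1 / real (card X choose card A)) =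
        (\<Sum>A\<in>F. \<Sum>x\<in>X - A. 1 / real (n choose card A))"
    proof -
      have "real (Suc n) * (1 / real (card X choose card A)) = (\<Sum>x\<in>X - A. 1 / real (n choose card A))"
        if A: "A \<in> F" for A
      proof -
        have sub: "A \<subset> X" using A False Suc.prems(2) by auto
        have lt: "card A < card X" using psubset_card_mono[OF Suc.prems(1) sub] .
        have cd: "card (X - A) = Suc n - card A"
          using card_Diff_subset[of A X] sub Suc.hyps(2) Suc.prems(1) by (auto intro: finite_subset)
        have "(Suc n - card A) * (Suc n choose card A) = Suc n * (n choose card A)"
          using binomial_absorb_comp[of "Suc n" "card A"] by simp
        then have "real (Suc n - card A) * real (Suc n choose card A) = real (Suc n) * real (n choose card A)"
          by (metis of_nat_mult)
        moreover have "real (Suc n choose card A) > 0" "real (n choose card A) > 0"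
          using lt Suc.hyps(2) by simp_all
        ultimately show ?thesis using cd Suc.hyps(2)[symmetric] by (simp add: field_simps)
      qed
      then show ?thesis unfolding sum_distrib_left by (intro sum.cong) auto
    qed
    also have "\<dots> = (\<Sum>A\<in>F. \<Sum>x | x \<in> X \<and> x \<notin> A. 1 / real (n choose card A))"
      by (intro sum.cong) auto
    also have "\<dots> = (\<Sum>x\<in>X. \<Sum>A\<in>{A\<in>F. x \<notin> A}. 1 / real (n choose card A))"
      by (rule sum.swap_restrict) (use finF Suc.prems in auto)
    also have "\<dots> \<le> (\<Sum>x\<in>X. 1)" by (rule sum_mono) (rule IH)
    also have "\<dots> = real (Suc n)" using Suc.hyps(2) by simp
    finally show ?thesis by simp
  qed
qed

text \<open>Sperner's theorem: every summand of the LYM sum is at least the reciprocal of the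
  central binomial coefficient.\<close>

lemma card_antichain_le:
  assumes "finite X" "F \<subseteq> Pow X" "\<And>A B. A \<in> F \<Longrightarrow> B \<in> F \<Longrightarrow> A \<subseteq> B \<Longrightarrow> A = B"
  shows "card F \<le> card X choose (card X div 2)"
proof -
  define b where "b = card X choose (card X div 2)"
  have b: "b > 0" by (simp add: b_def)
  have "real (card F) / real b = (\<Sum>A\<in>F. 1 / real b)" by simp
  also have "\<dots> \<le> (\<Sum>A\<in>F. 1 / real (card X choose card A))"
  proof (rule sum_mono)
    fix A assume "A \<in> F"
    then have "card A \<le> card X" using assms by (auto intro: card_mono)
    then have "0 < card X choose card A" by simp
    moreover have "card X choose card A \<le> b" unfolding b_def by (rule binomial_maximum)
    ultimately show "1 / real b \<le> 1 / real (card X choose card A)"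
      by (intro divide_left_mono mult_pos_pos) linarith+
  qed
  also have "\<dots> \<le> 1" by (rule sum_inverse_binomial_antichain_le_1) (use assms in auto)
  finally have "real (card F) \<le> real b" using b by (simp add: field_simps)
  then show ?thesis by (simp add: b_def)
qed

section \<open>Explicit bounds for central binomial coefficients\<close>

text \<open>Consecutive coefficients have ratio \<open>2 * (2 * m + 1) / (m + 1)\<close>. With the
  factor \<open>sqrt (2 * m + 1)\<close> the induction step reduces to
  \<open>(2 * m + 1) * (2 * m + 3) \<le> (2 * m + 2)^2\<close>.\<close>

lemma central_binomial_even_le: "real ((2 * m) choose m) * sqrt (2 * m + 1) \<le> 4 ^ m"
proof (induction m)
  case (Suc m)
  have "(Suc m) * ((2 * Suc m) choose Suc m) = (2 * (2 * m + 1)) * ((2 * m) choose m)"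
  proof -
    have 1: "Suc m * (Suc (2*m+1) choose Suc m) = Suc (2*m+1) * ((2*m+1) choose m)"
      using Suc_times_binomial_eq[of "2*m+1" m] by (simp only: mult.commute)
    have 2: "(2*m+1 - m) * ((2*m+1) choose m) = (2*m+1) * ((2*m) choose m)"
      using binomial_absorb_comp[of "2*m+1" m] by simp
    have "Suc m * (Suc m * (Suc (2*m+1) choose Suc m)) = 2 * Suc m * (Suc m * ((2*m+1) choose m))"
      unfolding 1 by simp
    also have "Suc m * ((2*m+1) choose m) = (2*m+1) * ((2*m) choose m)" using 2 by simp
    finally have "Suc m * (Suc m * (Suc (2*m+1) choose Suc m)) =
        Suc m * (2 * ((2*m+1) * ((2*m) choose m)))"
      by (simp only: ac_simps)
    then have "Suc m * (Suc (2*m+1) choose Suc m) = 2 * ((2*m+1) * ((2*m) choose m))"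
      by (simp only: mult_cancel1 nat.simps simp_thms)
    moreover have "2 * Suc m = Suc (2*m+1)" by simp
    ultimately show ?thesis by (simp only: mult.assoc)
  qed
  from arg_cong[where f = real, OF this]
  have e: "real (Suc m) * real ((2 * Suc m) choose Suc m) = 2 * (2 * real m + 1) * real ((2 * m) choose m)"
    by (simp only: of_nat_1 of_nat_add of_nat_mult of_nat_numeral)
  have "sqrt (2 * real m + 1) * sqrt (2 * real m + 3) \<le> 2 * real m + 2"
  proof -
    have "sqrt (2 * real m + 1) * sqrt (2 * real m + 3) = sqrt ((2 * real m + 1) * (2 * real m + 3))"
      by (rule real_sqrt_mult[symmetric])
    also have "\<dots> \<le> sqrt ((2 * real m + 2)\<^sup>2)"
      unfolding real_sqrt_le_iff by (simp add: power2_eq_square algebra_simps)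
    finally show ?thesis by simp
  qed
  then have s: "(2 * real m + 1) * sqrt (2 * real m + 3) \<le> (2 * real m + 2) * sqrt (2 * real m + 1)"
    using mult_left_mono[of "sqrt (2 * real m + 1) * sqrt (2 * real m + 3)" "2 * real m + 2" "sqrt (2 * real m + 1)"]
    by (simp add: mult.assoc[symmetric]) (simp only: mult.commute)
  have "real (Suc m) * (real ((2 * Suc m) choose Suc m) * sqrt (2 * Suc m + 1)) =
      2 * real ((2 * m) choose m) * ((2 * real m + 1) * sqrt (2 * real m + 3))"
    by (subst mult.assoc[symmetric], subst e) (simp add: algebra_simps)
  also have "\<dots> \<le> 2 * real ((2 * m) choose m) * ((2 * real m + 2) * sqrt (2 * real m + 1))"
    by (rule mult_left_mono[OF s]) simp
  also have "\<dots> = 4 * real (Suc m) * (real ((2 * m) choose m) * sqrt (2 * m + 1))"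
    by (simp add: algebra_simps)
  also have "\<dots> \<le> 4 * real (Suc m) * 4 ^ m" by (rule mult_left_mono[OF Suc.IH]) simp
  finally have "real (Suc m) * (real ((2 * Suc m) choose Suc m) * sqrt (2 * Suc m + 1)) \<le>
      real (Suc m) * 4 ^ Suc m" by (simp only: power_Suc ac_simps)
  then show ?case by (rule mult_left_le_imp_le) simp
qed simp

lemma central_binomial_le: "real (n choose (n div 2)) \<le> 2 ^ n / sqrt (real n + 1)"
proof -
  have "real (n choose (n div 2)) * sqrt (real n + 1) \<le> 2 ^ n"
  proof (cases "even n")
    case True
    then obtain m where "n = 2 * m" by blast
    then show ?thesis using central_binomial_even_le[of m] by (simp add: power_mult add.commute)
  next
    case False
    then obtain m where n: "n = 2 * m + 1" using oddE by blast
    \<comment> \<open>For odd \<open>n\<close> the two middle coefficients are equal and add up to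
      the next even central one.\<close>
    have "(2 * Suc m) choose Suc m = ((2*m+1) choose m) + ((2*m+1) choose Suc m)" by simp
    also have "(2*m+1) choose Suc m = (2*m+1) choose m" using binomial_symmetric[of m "2*m+1"] by simp
    finally have d: "(2 * Suc m) choose Suc m = 2 * (n choose m)" using n by simp
    have "real (n choose m) * sqrt (real n + 1) \<le> real (n choose m) * sqrt (real (2 * Suc m + 1))"
      by (intro mult_left_mono) (auto simp: n)
    also have "2 * \<dots> = real ((2 * Suc m) choose Suc m) * sqrt (real (2 * Suc m + 1))" unfolding d by simp
    also have "\<dots> \<le> 4 ^ Suc m" using central_binomial_even_le[of "Suc m"] by simp
    also have "(4::real) ^ Suc m = 2 * 2 ^ n" by (simp add: n power_mult)
    finally show ?thesis using n by simp
  qed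
  then show ?thesis by (simp add: field_simps)
qed

text \<open>The ratio to \<open>2 ^ n\<close> does not increase, and it is exactly
  \<open>3 / 8\<close> at \<open>n = 3\<close>; at \<open>n = 2\<close> it is \<open>1 / 2\<close>.
  Doubled for the two targets 1 and -1, the bound becomes the \<open>3 / 4\<close> of
  \<open>small_ball\<close>.\<close>

lemma central_binomial_le_three_eighths:
  assumes "n \<ge> 3"
  shows "8 * (n choose (n div 2)) \<le> 3 * 2 ^ n"
  using assms
proof (induction n rule: nat_induct_at_least)
  case base
  have "(3::nat) div 2 = 1" by simp
  then show ?case by simp
next
  case (Suc n)
  obtain m where m: "Suc n div 2 = Suc m" using Suc.hyps by (cases "Suc n div 2") auto
  have "Suc n choose (Suc n div 2) = (n choose m) + (n choose Suc m)" unfolding m by simp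
  also have "\<dots> \<le> 2 * (n choose (n div 2))"
    using binomial_maximum[of n m] binomial_maximum[of n "Suc m"] by simp
  finally show ?case using Suc.IH by simp
qed

section \<open>Signed sums\<close>

definition pm :: "'a set \<Rightarrow> 'a \<Rightarrow> real" where
  "pm A i = (if i \<in> A then 1 else -1)"

text \<open>The argument of Erdos: after flipping the signs at negative coefficients, enlarging the
  set strictly increases the sum, so the sets with a given sum form an antichain.\<close>

lemma littlewood_offord:
  fixes c :: "'a \<Rightarrow> real"
  assumes "finite I" "\<And>i. i \<in> I \<Longrightarrow> c i \<noteq> 0"
  shows "card {A. A \<subseteq> I \<and> (\<Sum>i\<in>I. c i * pm A i) = x} \<le> card I choose (card I div 2)"
proof -
  \<comment> \<open>The flip: membership is complemented exactly where \<open>c i < 0\<close>, which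
    replaces every \<open>c i\<close> by its absolute value.\<close>
  define tw where "tw A = {i\<in>I. i \<in> A \<longleftrightarrow> 0 < c i}" for A
  let ?S = "{A. A \<subseteq> I \<and> (\<Sum>i\<in>I. c i * pm A i) = x}"
  have inj: "inj_on tw ?S"
  proof (rule inj_onI)
    fix A B assume "A \<in> ?S" "B \<in> ?S" "tw A = tw B"
    then show "A = B" unfolding tw_def by fast
  qed
  have eq: "(\<Sum>i\<in>I. c i * pm A i) = (\<Sum>i\<in>I. \<bar>c i\<bar> * pm (tw A) i)" for A
    using assms(2) by (intro sum.cong) (force simp: tw_def pm_def)+
  have "tw A = tw B" if AB: "A \<in> ?S" "B \<in> ?S" "tw A \<subseteq> tw B" for A B
  proof (rule ccontr)
    assume "tw A \<noteq> tw B"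
    then obtain i where i: "i \<in> tw B" "i \<notin> tw A" using AB by blast
    have "(\<Sum>i\<in>I. \<bar>c i\<bar> * pm (tw A) i) < (\<Sum>i\<in>I. \<bar>c i\<bar> * pm (tw B) i)"
    proof (rule sum_strict_mono_ex1[OF assms(1)])
      show "\<forall>i\<in>I. \<bar>c i\<bar> * pm (tw A) i \<le> \<bar>c i\<bar> * pm (tw B) i"
        using AB(3) by (auto simp: pm_def)
      have "i \<in> I" using i by (auto simp: tw_def)
      then show "\<exists>i\<in>I. \<bar>c i\<bar> * pm (tw A) i < \<bar>c i\<bar> * pm (tw B) i"
        using i assms(2)[of i] by (intro bexI[of _ i]) (auto simp: pm_def)
    qed
    then show False using AB(1,2) eq[of A] eq[of B] by simp
  qed
  then have "card (tw ` ?S) \<le> card I choose (card I div 2)"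
    by (intro card_antichain_le) (use assms(1) in \<open>auto simp: tw_def\<close>)
  then show ?thesis using inj by (simp add: card_image)
qed

text \<open>Bounds the probability that a random signed sum with \<open>j \<ge> 2\<close> nonzero
  coefficients is 1 or -1. The second term is Littlewood--Offord for two targets; the first keeps
  the bound away from 1 for small \<open>j\<close>.\<close>

definition small_ball :: "nat \<Rightarrow> real" where
  "small_ball j = min (3 / 4) (2 / sqrt (real j + 1))"

lemma card_unit_signed_sums_le:
  fixes c :: "'a \<Rightarrow> real"
  assumes "finite I" "\<And>i. i \<in> I \<Longrightarrow> c i \<noteq> 0" "card I \<ge> 2"
  shows "real (card {A. A \<subseteq> I \<and> \<bar>\<Sum>i\<in>I. c i * pm A i\<bar> = 1}) \<le> small_ball (card I) * 2 ^ card I"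
proof -
  let ?S = "\<lambda>x. {A. A \<subseteq> I \<and> (\<Sum>i\<in>I. c i * pm A i) = x}"
  let ?U = "{A. A \<subseteq> I \<and> \<bar>\<Sum>i\<in>I. c i * pm A i\<bar> = 1}"
  define j where "j = card I"
  have "?U = ?S 1 \<union> ?S (-1)" by (auto simp: abs_if split: if_splits)
  then have "card ?U \<le> card (?S 1) + card (?S (-1))"
    using card_Un_le[of "?S 1" "?S (-1)"] by (simp only:)
  also have "\<dots> \<le> 2 * (j choose (j div 2))"
    using littlewood_offord[of I c 1] littlewood_offord[of I c "-1"] assms by (simp add: j_def)
  finally have u: "card ?U \<le> 2 * (j choose (j div 2))" .
  then have "real (card ?U) \<le> 2 * real (j choose (j div 2))" by linarith
  also have "\<dots> \<le> 2 * (2 ^ j / sqrt (real j + 1))"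
    by (rule mult_left_mono[OF central_binomial_le]) simp
  finally have 1: "real (card ?U) \<le> 2 / sqrt (real j + 1) * 2 ^ j" by simp
  have 2: "real (card ?U) \<le> 3 / 4 * 2 ^ j"
  proof (cases "j \<ge> 3")
    case True
    then have "4 * card ?U \<le> 3 * 2 ^ j" using u central_binomial_le_three_eighths[of j] by linarith
    then have "real (4 * card ?U) \<le> real (3 * 2 ^ j)" by (rule of_nat_mono)
    then show ?thesis by simp
  next
    case False
    then have "j = 2" using assms(3) by (simp add: j_def)
    then obtain a b where I: "I = {a, b}" "a \<noteq> b" unfolding j_def by (auto simp: card_2_iff)
    \<comment> \<open>For two coefficients Littlewood--Offord is vacuous: twice the central
      coefficient 2 is all four sign choices. One choice fails, since otherwise
      \<open>c a + c b\<close> and \<open>c a - c b\<close> would have equal squares.\<close>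
    have "?U \<noteq> Pow I"
    proof
      assume "?U = Pow I"
      then have "I \<in> ?U" "{a} \<in> ?U" using I by auto
      then have "\<bar>c a + c b\<bar> = 1" "\<bar>c a - c b\<bar> = 1" using I by (auto simp: pm_def)
      then have "(c a + c b)\<^sup>2 = 1" "(c a - c b)\<^sup>2 = 1" by (metis abs_1 power2_abs power_one)+
      moreover have "(c a + c b)\<^sup>2 - (c a - c b)\<^sup>2 = 4 * (c a * c b)"
        by (simp add: power2_eq_square algebra_simps)
      ultimately have "c a * c b = 0" by simp
      then show False using assms(2) I by auto
    qed
    then have "card ?U < card (Pow I)" using assms(1) by (intro psubset_card_mono) auto
    then show ?thesis using \<open>j = 2\<close> assms(1) by (simp add: card_Pow j_def)
  qed
  show ?thesis using 1 2 unfolding small_ball_def j_def[symmetric] by (simp add: min_def)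
qed

section \<open>Tuples with a combination in the cube\<close>

text \<open>
  A tuple of \<open>\<plusminus>1\<close> vectors indexed by \<open>K\<close> is stored by coordinates: \<open>r t\<close> is the set of those vectors
  whose coordinate \<open>t\<close> is \<open>+1\<close>.
\<close>

definition collapsing :: "'i set \<Rightarrow> 't set \<Rightarrow> ('t \<Rightarrow> 'i set) \<Rightarrow> bool" where
  "collapsing K T r \<longleftrightarrow> (\<exists>c :: 'i \<Rightarrow> real. 2 \<le> card {i\<in>K. c i \<noteq> 0} \<and>
     (\<forall>t\<in>T. \<bar>\<Sum>i\<in>K. c i * pm (r t) i\<bar> = 1))"

lemma card_subsets_with_trace:
  assumes "finite K" "I \<subseteq> K"
  shows "card {B. B \<subseteq> K \<and> P (B \<inter> I)} = card {A. A \<subseteq> I \<and> P A} * 2 ^ (card K - card I)"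
proof -
  have "bij_betw (\<lambda>(A, D). A \<union> D) ({A. A \<subseteq> I \<and> P A} \<times> Pow (K - I)) {B. B \<subseteq> K \<and> P (B \<inter> I)}"
  proof (rule bij_betw_byWitness[where f' = "\<lambda>B. (B \<inter> I, B - I)"])
    have *: "(A \<union> D) \<inter> I = A" "(A \<union> D) - I = D" if "A \<subseteq> I" "D \<subseteq> K - I" for A D
      using that by blast+
    show "\<forall>x\<in>{A. A \<subseteq> I \<and> P A} \<times> Pow (K - I).
        ((case x of (A, D) \<Rightarrow> A \<union> D) \<inter> I, (case x of (A, D) \<Rightarrow> A \<union> D) - I) = x"
      using * by auto
    show "\<forall>B\<in>{B. B \<subseteq> K \<and> P (B \<inter> I)}. (case (B \<inter> I, B - I) of (A, D) \<Rightarrow> A \<union> D) = B" by blast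
    show "(\<lambda>(A, D). A \<union> D) ` ({A. A \<subseteq> I \<and> P A} \<times> Pow (K - I)) \<subseteq> {B. B \<subseteq> K \<and> P (B \<inter> I)}"
    proof (rule image_subsetI)
      fix x assume "x \<in> {A. A \<subseteq> I \<and> P A} \<times> Pow (K - I)"
      then obtain A D where x: "x = (A, D)" "A \<subseteq> I" "P A" "D \<subseteq> K - I" by blast
      then have "P ((A \<union> D) \<inter> I)" using * by simp
      moreover have "A \<union> D \<subseteq> K" using x assms by blast
      ultimately show "(case x of (A, D) \<Rightarrow> A \<union> D) \<in> {B. B \<subseteq> K \<and> P (B \<inter> I)}" by (simp add: x(1))
    qed
    show "(\<lambda>B. (B \<inter> I, B - I)) ` {B. B \<subseteq> K \<and> P (B \<inter> I)} \<subseteq> {A. A \<subseteq> I \<and> P A} \<times> Pow (K - I)"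
      by blast
  qed
  then have "card {B. B \<subseteq> K \<and> P (B \<inter> I)} = card ({A. A \<subseteq> I \<and> P A} \<times> Pow (K - I))"
    by (rule bij_betw_same_card[symmetric])
  also have "\<dots> = card {A. A \<subseteq> I \<and> P A} * 2 ^ (card K - card I)"
    using assms finite_subset[OF assms(2,1)]
    by (simp add: card_cartesian_product card_Pow card_Diff_subset)
  finally show ?thesis .
qed

lemma card_unit_signed_sums_on_superset_le:
  fixes c :: "'a \<Rightarrow> real"
  assumes "finite K" "card {i\<in>K. c i \<noteq> 0} \<ge> 2"
  shows "real (card {B. B \<subseteq> K \<and> \<bar>\<Sum>i\<in>K. c i * pm B i\<bar> = 1})
    \<le> small_ball (card {i\<in>K. c i \<noteq> 0}) * 2 ^ card K"
proof -
  define I where "I = {i\<in>K. c i \<noteq> 0}"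
  have I: "I \<subseteq> K" "finite I" using assms by (auto simp: I_def)
  have "(\<Sum>i\<in>K. c i * pm B i) = (\<Sum>i\<in>I. c i * pm (B \<inter> I) i)" for B
  proof -
    have "(\<Sum>i\<in>K. c i * pm B i) = (\<Sum>i\<in>I. c i * pm B i)"
      by (rule sum.mono_neutral_right) (use assms in \<open>auto simp: I_def\<close>)
    also have "\<dots> = (\<Sum>i\<in>I. c i * pm (B \<inter> I) i)" by (rule sum.cong) (auto simp: pm_def)
    finally show ?thesis .
  qed
  then have "card {B. B \<subseteq> K \<and> \<bar>\<Sum>i\<in>K. c i * pm B i\<bar> = 1} =
      card {A. A \<subseteq> I \<and> \<bar>\<Sum>i\<in>I. c i * pm A i\<bar> = 1} * 2 ^ (card K - card I)"
    using card_subsets_with_trace[OF assms(1) I(1), of "\<lambda>A. \<bar>\<Sum>i\<in>I. c i * pm A i\<bar> = 1"] by simp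
  then have "real (card {B. B \<subseteq> K \<and> \<bar>\<Sum>i\<in>K. c i * pm B i\<bar> = 1}) =
      real (card {A. A \<subseteq> I \<and> \<bar>\<Sum>i\<in>I. c i * pm A i\<bar> = 1}) * 2 ^ (card K - card I)" by simp
  also have "\<dots> \<le> (small_ball (card I) * 2 ^ card I) * 2 ^ (card K - card I)"
    by (intro mult_right_mono card_unit_signed_sums_le) (use assms I in \<open>auto simp: I_def\<close>)
  also have "\<dots> = small_ball (card I) * 2 ^ card K"
    using card_mono[OF assms(1) I(1)] by (simp add: power_add[symmetric])
  finally show ?thesis by (simp add: I_def)
qed

text \<open>The event of the union bound with its data fixed: \<open>I\<close> is the exact support
  of the coefficients, and the rows in \<open>R\<close> span all rows. Spanning is demanded only on
  \<open>I\<close>, since a combination sees no other columns.\<close>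

definition collapsing_on :: "'i set \<Rightarrow> 't set \<Rightarrow> 'i set \<Rightarrow> 't set \<Rightarrow> ('t \<Rightarrow> 'i set) set" where
  "collapsing_on K T I R = {r \<in> T \<rightarrow>\<^sub>E Pow K.
     (\<exists>c :: 'i \<Rightarrow> real. {i\<in>K. c i \<noteq> 0} = I \<and> (\<forall>t\<in>T. \<bar>\<Sum>i\<in>K. c i * pm (r t) i\<bar> = 1)) \<and>
     (\<forall>t\<in>T. \<exists>a. \<forall>i\<in>I. pm (r t) i = (\<Sum>s\<in>R. a s * pm (r s) i))}"

text \<open>
  The coefficients \<open>c\<close> need not be determined by the coordinates in \<open>R\<close>, but since these span all
  coordinates, any choice \<open>cs\<close> that agrees with \<open>c\<close> on \<open>R\<close> agrees with it everywhere. Hence a union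
  bound over the data on \<open>R\<close> suffices.
\<close>

lemma card_collapsing_on_le:
  assumes fin: "finite K" "finite T" and R: "R \<subseteq> T" and I: "2 \<le> card I"
  shows "real (card (collapsing_on K T I R)) \<le>
    (2 * 2 ^ card K) ^ card R * (small_ball (card I) * 2 ^ card K) ^ (card T - card R)"
proof -
  define ip where "ip c B = (\<Sum>i\<in>K. c i * pm B i)" for c :: "'a \<Rightarrow> real" and B
  define G where "G c = {B. B \<subseteq> K \<and> \<bar>ip c B\<bar> = 1}" for c
  define adm where "adm p c \<longleftrightarrow> {i\<in>K. c i \<noteq> 0} = I \<and> (\<forall>t\<in>R. ip c (snd p t) = fst p t)"
    for p :: "('b \<Rightarrow> real) \<times> ('b \<Rightarrow> 'a set)" and c
  define P where "P = {p \<in> (R \<rightarrow>\<^sub>E {-1, 1}) \<times> (R \<rightarrow>\<^sub>E Pow K). \<exists>c. adm p c}"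
  define cs where "cs p = (SOME c. adm p c)" for p
  \<comment> \<open>\<open>cs p\<close> depends on the data \<open>p\<close> alone, so the rows
    outside \<open>R\<close> range independently over the one set \<open>G (cs p)\<close> and the
    block is a product.\<close>
  define blk where "blk p = (\<Pi>\<^sub>E t\<in>T. if t \<in> R then {snd p t} else G (cs p))" for p
  have finR: "finite R" using fin R by (auto intro: finite_subset)
  have finP0: "finite ((R \<rightarrow>\<^sub>E {-1, 1::real}) \<times> (R \<rightarrow>\<^sub>E Pow K))"
    using fin finR by (intro finite_cartesian_product finite_PiE) auto
  then have finP: "finite P" unfolding P_def by simp
  have cs: "adm p (cs p)" if "p \<in> P" for p
  proof -
    have "\<exists>c. adm p c" using that unfolding P_def by simp
    then show ?thesis unfolding cs_def by (rule someI_ex)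
  qed
  have finG: "finite (G c)" for c unfolding G_def using fin by simp
  have "collapsing_on K T I R \<subseteq> (\<Union>p\<in>P. blk p)"
  proof
    fix r assume r: "r \<in> collapsing_on K T I R"
    then obtain c where c: "{i\<in>K. c i \<noteq> 0} = I" "\<forall>t\<in>T. \<bar>ip c (r t)\<bar> = 1"
      unfolding collapsing_on_def ip_def by blast
    have span: "\<exists>a. \<forall>i\<in>I. pm (r t) i = (\<Sum>s\<in>R. a s * pm (r s) i)" if "t \<in> T" for t
      using r that unfolding collapsing_on_def by blast
    have rT: "r \<in> T \<rightarrow>\<^sub>E Pow K" using r by (simp add: collapsing_on_def)
    define p where "p = (restrict (\<lambda>t. ip c (r t)) R, restrict r R)"
    have ap: "adm p c" using c by (simp add: adm_def p_def)
    moreover have "p \<in> (R \<rightarrow>\<^sub>E {-1, 1}) \<times> (R \<rightarrow>\<^sub>E Pow K)"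
    proof -
      have "ip c (r t) \<in> {-1, 1}" if "t \<in> R" for t
        using c(2) R that by (auto simp: abs_if split: if_splits)
      moreover have "r t \<in> Pow K" if "t \<in> R" for t using rT R that by (auto simp: PiE_iff)
      ultimately show ?thesis unfolding p_def by (simp add: PiE_iff)
    qed
    ultimately have pP: "p \<in> P" unfolding P_def by blast
    have csI: "{i\<in>K. cs p i \<noteq> 0} = I" and csR: "\<And>t. t \<in> R \<Longrightarrow> ip (cs p) (r t) = ip c (r t)"
      using cs[OF pP] by (auto simp: adm_def p_def)
    have expand: "ip x (r t) = (\<Sum>s\<in>R. a s * ip x (r s))"
      if x: "{i\<in>K. x i \<noteq> 0} = I" and a: "\<forall>i\<in>I. pm (r t) i = (\<Sum>s\<in>R. a s * pm (r s) i)" for x t a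
    proof -
      have 1: "ip x B = (\<Sum>i\<in>I. x i * pm B i)" for B
        unfolding ip_def by (rule sum.mono_neutral_right) (use fin x in auto)
      have "(\<Sum>i\<in>I. x i * pm (r t) i) = (\<Sum>i\<in>I. x i * (\<Sum>s\<in>R. a s * pm (r s) i))"
        by (rule sum.cong[OF refl]) (rule arg_cong[OF bspec[OF a]])
      also have "\<dots> = (\<Sum>i\<in>I. \<Sum>s\<in>R. a s * (x i * pm (r s) i))"
        by (simp add: sum_distrib_left mult.left_commute)
      also have "\<dots> = (\<Sum>s\<in>R. a s * (\<Sum>i\<in>I. x i * pm (r s) i))"
        by (subst sum.swap) (simp add: sum_distrib_left)
      finally show ?thesis unfolding 1 .
    qed
    have "\<bar>ip (cs p) (r t)\<bar> = 1" if t: "t \<in> T" for t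
    proof -
      obtain a where a: "\<forall>i\<in>I. pm (r t) i = (\<Sum>s\<in>R. a s * pm (r s) i)"
        using span[OF t] by (elim exE)
      have "ip (cs p) (r t) = (\<Sum>s\<in>R. a s * ip (cs p) (r s))" by (rule expand[OF csI a])
      also have "\<dots> = (\<Sum>s\<in>R. a s * ip c (r s))" by (rule sum.cong) (auto simp: csR)
      also have "\<dots> = ip c (r t)" by (rule expand[OF c(1) a, symmetric])
      finally show ?thesis using c(2) t by simp
    qed
    then have "r \<in> blk p" using rT by (auto simp: blk_def PiE_iff G_def p_def)
    then show "r \<in> (\<Union>p\<in>P. blk p)" using pP by blast
  qed
  moreover have "finite (\<Union>p\<in>P. blk p)"
    using finP fin finG unfolding blk_def by (intro finite_UN_I finite_PiE) auto
  ultimately have "card (collapsing_on K T I R) \<le> card (\<Union>p\<in>P. blk p)" by (intro card_mono)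
  also have "\<dots> \<le> (\<Sum>p\<in>P. card (blk p))" by (rule card_UN_le[OF finP])
  finally have "real (card (collapsing_on K T I R)) \<le> (\<Sum>p\<in>P. real (card (blk p)))"
    by (simp only: of_nat_sum[symmetric] of_nat_le_iff)
  also have "\<dots> \<le> (\<Sum>p\<in>P. (small_ball (card I) * 2 ^ card K) ^ (card T - card R))"
  proof (rule sum_mono)
    fix p assume p: "p \<in> P"
    have csI: "{i\<in>K. cs p i \<noteq> 0} = I" using cs[OF p] by (simp add: adm_def)
    have "card (blk p) = (\<Prod>t\<in>T. if t \<in> R then 1 else card (G (cs p)))"
      unfolding blk_def card_PiE[OF fin(2)] by (rule prod.cong) auto
    also have "\<dots> = (\<Prod>t\<in>T - R. card (G (cs p)))"
      by (rule prod.mono_neutral_cong_right) (use fin in auto)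
    also have "\<dots> = card (G (cs p)) ^ (card T - card R)" using R finR by (simp add: card_Diff_subset)
    finally have "real (card (blk p)) = real (card (G (cs p))) ^ (card T - card R)" by simp
    also have "\<dots> \<le> (small_ball (card I) * 2 ^ card K) ^ (card T - card R)"
      using card_unit_signed_sums_on_superset_le[OF fin(1), of "cs p"] I
      unfolding csI G_def ip_def by (intro power_mono) auto
    finally show "real (card (blk p)) \<le> (small_ball (card I) * 2 ^ card K) ^ (card T - card R)" .
  qed
  also have "\<dots> = real (card P) * (small_ball (card I) * 2 ^ card K) ^ (card T - card R)" by simp
  also have "\<dots> \<le> (2 * 2 ^ card K) ^ card R * (small_ball (card I) * 2 ^ card K) ^ (card T - card R)"
  proof (rule mult_right_mono)
    \<comment> \<open>Each coordinate in \<open>R\<close> contributes one of two values and one of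
      \<open>2 ^ card K\<close> rows.\<close>
    have "card P \<le> card ((R \<rightarrow>\<^sub>E {-1, 1::real}) \<times> (R \<rightarrow>\<^sub>E Pow K))"
      using finP0 unfolding P_def by (intro card_mono) auto
    also have "\<dots> = (2 * 2 ^ card K) ^ card R"
    proof -
      have "card (R \<rightarrow>\<^sub>E {-1, 1::real}) = 2 ^ card R" using finR by (simp add: card_PiE numeral_2_eq_2)
      moreover have "card (R \<rightarrow>\<^sub>E Pow K) = (2 ^ card K) ^ card R" using finR fin by (simp add: card_PiE card_Pow)
      ultimately show ?thesis by (simp only: card_cartesian_product power_mult_distrib)
    qed
    finally have "real (card P) \<le> real ((2 * 2 ^ card K) ^ card R)" by (simp only: of_nat_le_iff)
    then show "real (card P) \<le> (2 * 2 ^ card K) ^ card R" by simp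
    show "0 \<le> (small_ball (card I) * 2 ^ card K) ^ (card T - card R)" by (simp add: small_ball_def)
  qed
  finally show ?thesis .
qed

lemma collapsing_cases:
  assumes fin: "finite K" "finite T" and le: "card K \<le> card T"
    and r: "r \<in> T \<rightarrow>\<^sub>E Pow K" "collapsing K T r"
  shows "\<exists>j\<in>{2..card K}. \<exists>I\<in>{I. I \<subseteq> K \<and> card I = j}. \<exists>R\<in>{R. R \<subseteq> T \<and> card R = j}.
    r \<in> collapsing_on K T I R"
proof -
  obtain c where c: "2 \<le> card {i\<in>K. c i \<noteq> 0}" "\<forall>t\<in>T. \<bar>\<Sum>i\<in>K. c i * pm (r t) i\<bar> = 1"
    using r(2) unfolding collapsing_def by blast
  define I where "I = {i\<in>K. c i \<noteq> 0}"
  have I: "I \<subseteq> K" "finite I" using fin by (auto simp: I_def)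
  have cI: "card I \<le> card K" using I fin by (simp add: card_mono)
  have "\<exists>R\<subseteq>T. card R \<le> card I \<and> (\<forall>t\<in>T. \<exists>a. \<forall>i\<in>I. pm (r t) i = (\<Sum>s\<in>R. a s * pm (r s) i))"
    using spanning_subfamily[OF I(2) fin(2), of "\<lambda>t. pm (r t)"] .
  then obtain R0 where R0: "R0 \<subseteq> T" "card R0 \<le> card I"
    "\<forall>t\<in>T. \<exists>a. \<forall>i\<in>I. pm (r t) i = (\<Sum>s\<in>R0. a s * pm (r s) i)" by (elim exE conjE)
  \<comment> \<open>Padding \<open>R0\<close> to exactly \<open>card I\<close> coordinates makes the
    bound depend on \<open>j\<close> only. There is room because
    \<open>card I \<le> card K \<le> card T\<close>; the added rows get coefficient 0.\<close>
  obtain R where R: "R0 \<subseteq> R" "R \<subseteq> T" "card R = card I"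
    using exists_subset_between[of R0 "card I" T] R0 cI le fin by auto
  have finR: "finite R" using R fin by (auto intro: finite_subset)
  have "\<exists>a. \<forall>i\<in>I. pm (r t) i = (\<Sum>s\<in>R. a s * pm (r s) i)" if t: "t \<in> T" for t
  proof -
    obtain a where a: "\<forall>i\<in>I. pm (r t) i = (\<Sum>s\<in>R0. a s * pm (r s) i)"
      using bspec[OF R0(3) t] by (elim exE)
    have "(\<Sum>s\<in>R. (if s \<in> R0 then a s else 0) * pm (r s) i) = (\<Sum>s\<in>R0. a s * pm (r s) i)" for i
      by (rule sum.mono_neutral_cong_right) (use R finR in auto)
    then have "\<forall>i\<in>I. pm (r t) i = (\<Sum>s\<in>R. (if s \<in> R0 then a s else 0) * pm (r s) i)"
      by (intro ballI) (simp only: bspec[OF a])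
    then show ?thesis by (intro exI[of _ "\<lambda>s. if s \<in> R0 then a s else 0"])
  qed
  then have "r \<in> collapsing_on K T I R"
    using r(1) c I_def unfolding collapsing_on_def by blast
  moreover have "card I \<in> {2..card K}" using c(1) cI by (simp add: I_def)
  ultimately show ?thesis using I R by blast
qed

lemma card_collapsing_le:
  assumes fin: "finite K" "finite T" and le: "card K \<le> card T"
  shows "real (card {r \<in> T \<rightarrow>\<^sub>E Pow K. collapsing K T r}) \<le>
    (\<Sum>j=2..card K. real (card K choose j) * real (card T choose j) *
      ((2 * 2 ^ card K) ^ j * (small_ball j * 2 ^ card K) ^ (card T - j)))"
proof -
  define Is where "Is j = {I. I \<subseteq> K \<and> card I = j}" for j
  define Rs where "Rs j = {R. R \<subseteq> T \<and> card R = j}" for j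
  let ?b = "\<lambda>j. (2 * 2 ^ card K) ^ j * (small_ball j * 2 ^ card K) ^ (card T - j) :: real"
  have finIR: "finite (Is j)" "finite (Rs j)" for j unfolding Is_def Rs_def using fin by auto
  have finC: "finite (collapsing_on K T I R)" for I R
  proof (rule finite_subset)
    show "collapsing_on K T I R \<subseteq> (T \<rightarrow>\<^sub>E Pow K)" unfolding collapsing_on_def by (rule Collect_restrict)
    show "finite (T \<rightarrow>\<^sub>E Pow K)" using fin by (intro finite_PiE) auto
  qed
  have "{r \<in> T \<rightarrow>\<^sub>E Pow K. collapsing K T r} \<subseteq>
      (\<Union>j\<in>{2..card K}. \<Union>I\<in>Is j. \<Union>R\<in>Rs j. collapsing_on K T I R)"
  proof
    fix r assume "r \<in> {r \<in> T \<rightarrow>\<^sub>E Pow K. collapsing K T r}"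
    then show "r \<in> (\<Union>j\<in>{2..card K}. \<Union>I\<in>Is j. \<Union>R\<in>Rs j. collapsing_on K T I R)"
      using collapsing_cases[OF fin le, of r] unfolding Is_def Rs_def by simp
  qed
  then have "card {r \<in> T \<rightarrow>\<^sub>E Pow K. collapsing K T r} \<le>
      card (\<Union>j\<in>{2..card K}. \<Union>I\<in>Is j. \<Union>R\<in>Rs j. collapsing_on K T I R)"
    by (rule card_mono[rotated]) (intro finite_UN_I finite_atLeastAtMost finIR finC)
  also have "\<dots> \<le> (\<Sum>j\<in>{2..card K}. \<Sum>I\<in>Is j. \<Sum>R\<in>Rs j. card (collapsing_on K T I R))"
    by (intro order_trans[OF card_UN_le] sum_mono finIR finite_atLeastAtMost order_refl)
  finally have "real (card {r \<in> T \<rightarrow>\<^sub>E Pow K. collapsing K T r}) \<le>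
      real (\<Sum>j\<in>{2..card K}. \<Sum>I\<in>Is j. \<Sum>R\<in>Rs j. card (collapsing_on K T I R))"
    by (rule of_nat_mono)
  also have "\<dots> = (\<Sum>j\<in>{2..card K}. \<Sum>I\<in>Is j. \<Sum>R\<in>Rs j. real (card (collapsing_on K T I R)))" by simp
  also have "\<dots> \<le> (\<Sum>j\<in>{2..card K}. \<Sum>I\<in>Is j. \<Sum>R\<in>Rs j. ?b j)"
  proof (intro sum_mono)
    fix j I R assume h: "j \<in> {2..card K}" "I \<in> Is j" "R \<in> Rs j"
    then have "card I = j" "card R = j" "R \<subseteq> T" by (auto simp: Is_def Rs_def)
    then show "real (card (collapsing_on K T I R)) \<le> ?b j"
      using card_collapsing_on_le[OF fin, of R I] h(1) by simp
  qed
  also have "\<dots> = (\<Sum>j=2..card K. real (card K choose j) * real (card T choose j) * ?b j)"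
    using fin by (simp add: Is_def Rs_def n_subsets mult.assoc)
  finally show ?thesis .
qed

section \<open>Asymptotics of the union bound\<close>

lemma small_ball_nonneg: "0 \<le> small_ball j"
  by (simp add: small_ball_def)

lemma small_ball_tendsto_0: "small_ball \<longlonglongrightarrow> 0"
proof (rule tendsto_sandwich)
  show "(\<lambda>_. 0) \<longlonglongrightarrow> (0::real)" by simp
  show "\<forall>\<^sub>F j in sequentially. 0 \<le> small_ball j" by (simp add: small_ball_nonneg)
  show "\<forall>\<^sub>F j in sequentially. small_ball j \<le> 2 / sqrt (real j + 1)" by (simp add: small_ball_def)
  show "(\<lambda>j. 2 / sqrt (real j + 1)) \<longlonglongrightarrow> 0" by real_asymp
qed

text \<open>For bounded \<open>j\<close> the binomials are polynomial in \<open>n\<close>, and the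
  constant \<open>3 / 4\<close> already gives exponential decay. The factor
  \<open>(4 / 3) ^ J\<close> pays for the \<open>j\<close> coordinates missing from the
  exponent.\<close>

lemma collapse_term_le_of_small:
  assumes "j \<le> J" "j \<le> k" "k \<le> n" "1 \<le> n"
  shows "real (k choose j) * real (n choose j) * (2 ^ j * small_ball j ^ (n - j))
    \<le> real n ^ J * real n ^ J * (2 ^ J * ((4 / 3) ^ J * (3 / 4) ^ n))"
proof -
  have nJ: "real n ^ j \<le> real n ^ J" using assms by (intro power_increasing) auto
  have "real (k choose j) \<le> real (k ^ j)" using binomial_le_pow[OF assms(2)] by (simp only: of_nat_le_iff)
  also have "\<dots> \<le> real n ^ j" using assms by (simp add: power_mono)
  also note nJ
  finally have 1: "real (k choose j) \<le> real n ^ J" .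
  have "real (n choose j) \<le> real (n ^ j)"
    using binomial_le_pow[of j n] assms by (simp only: of_nat_le_iff)
  then have 2: "real (n choose j) \<le> real n ^ J" using nJ by (simp only: of_nat_power)
  have 3: "(2::real) ^ j \<le> 2 ^ J" using assms by (intro power_increasing) auto
  have "small_ball j ^ (n - j) \<le> (3 / 4) ^ (n - j)"
    by (intro power_mono small_ball_nonneg) (simp add: small_ball_def)
  also have "\<dots> = (4 / 3) ^ j * (3 / 4) ^ n"
    using assms by (simp add: power_diff power_divide field_simps)
  also have "\<dots> \<le> (4 / 3) ^ J * (3 / 4) ^ n"
    using assms by (intro mult_right_mono power_increasing) auto
  finally have 4: "small_ball j ^ (n - j) \<le> (4 / 3) ^ J * (3 / 4) ^ n" .
  show ?thesis
    by (intro mult_mono 1 2 3 4) (auto simp: small_ball_nonneg)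
qed

text \<open>Here \<open>d\<close> is the relative gap between \<open>k\<close> and \<open>n\<close>.
  Two binomials and \<open>2 ^ j\<close> cost at most \<open>8 ^ n\<close>; at least
  \<open>d * n\<close> coordinates remain, and a factor \<open>2 powr (-4 / d)\<close> for each
  gives \<open>16 ^ n\<close> in return.\<close>

lemma collapse_term_le_of_large:
  fixes d :: real
  assumes "small_ball j \<le> 2 powr (-4 / d)" "0 < d" "real k \<le> (1 - d) * real n" "j \<le> k" "k \<le> n"
  shows "real (k choose j) * real (n choose j) * (2 ^ j * small_ball j ^ (n - j)) \<le> (1 / 2) ^ n"
proof -
  have 1: "real (k choose j) \<le> 2 ^ n"
  proof -
    have "real (k choose j) \<le> real (2 ^ k)" using binomial_le_pow2[of k j] by (simp only: of_nat_le_iff)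
    also have "\<dots> \<le> 2 ^ n" using assms by (simp add: power_increasing)
    finally show ?thesis .
  qed
  have "real (n choose j) \<le> real (2 ^ n)" using binomial_le_pow2[of n j] by (simp only: of_nat_le_iff)
  then have 2: "real (n choose j) \<le> 2 ^ n" by simp
  have 3: "(2::real) ^ j \<le> 2 ^ n" using assms by (intro power_increasing) auto
  have "small_ball j ^ (n - j) \<le> (2 powr (-4 / d)) ^ (n - j)"
    using assms(1) by (intro power_mono small_ball_nonneg)
  also have "\<dots> = 2 powr (-4 / d * real (n - j))" by (simp add: powr_powr powr_realpow[symmetric])
  also have "\<dots> \<le> 2 powr (-4 * real n)"
  proof (rule powr_mono)
    have "real n * d \<le> real (n - j)" using assms by (simp add: algebra_simps of_nat_diff)
    then show "-4 / d * real (n - j) \<le> -4 * real n" using assms(2) by (simp add: field_simps)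
  qed simp
  also have "\<dots> = (1 / 16) ^ n"
    by (simp add: powr_minus powr_realpow[symmetric] powr_powr[symmetric] power_divide inverse_eq_divide)
  finally have 4: "small_ball j ^ (n - j) \<le> (1 / 16) ^ n" .
  have "real (k choose j) * real (n choose j) * (2 ^ j * small_ball j ^ (n - j))
      \<le> 2 ^ n * 2 ^ n * (2 ^ n * (1 / 16) ^ n)"
    by (intro mult_mono 1 2 3 4) (auto simp: small_ball_nonneg)
  also have "\<dots> = (1 / 2) ^ n" by (simp add: power_mult_distrib[symmetric])
  finally show ?thesis .
qed

text \<open>The sequence is the \<open>Suc m\<close>-th power of \<open>n * s ^ n\<close>, where
  \<open>s\<close> is the \<open>Suc m\<close>-th root of \<open>r\<close>.\<close>

lemma polynomial_times_geometric_tendsto_0: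
  fixes r :: real
  assumes "0 \<le> r" "r < 1"
  shows "(\<lambda>n. real n ^ Suc m * r ^ n) \<longlonglongrightarrow> 0"
proof -
  define s where "s = root (Suc m) r"
  have s: "0 \<le> s" "s < 1" "s ^ Suc m = r" using assms real_root_pow_pos2[of "Suc m" r] unfolding s_def by (auto simp del: power_Suc)
  have "(\<lambda>n. real n * s ^ n) \<longlonglongrightarrow> 0" using s by (intro powser_times_n_limit_0) auto
  then have "(\<lambda>n. (real n * s ^ n) ^ Suc m) \<longlonglongrightarrow> 0 ^ Suc m" by (rule tendsto_power)
  moreover have "(real n * s ^ n) ^ Suc m = real n ^ Suc m * r ^ n" for n
    using s(3) by (metis power_mult power_mult_distrib mult.commute)
  ultimately show ?thesis by (simp only: power_0_Suc)
qed

text \<open>Uniform in \<open>k\<close>: there are at most \<open>n\<close> terms, and the bounds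
  for both ranges of \<open>j\<close> depend on \<open>n\<close> only.\<close>

lemma eventually_collapse_sum_le_half:
  fixes d :: real
  assumes "0 < d" "d < 1"
  shows "\<forall>\<^sub>F n in sequentially. \<forall>k. real k \<le> (1 - d) * real n \<longrightarrow>
    (\<Sum>j=2..k. real (k choose j) * real (n choose j) * (2 ^ j * small_ball j ^ (n - j))) \<le> 1 / 2"
proof -
  have "\<forall>\<^sub>F j in sequentially. small_ball j < 2 powr (-4 / d)"
    using small_ball_tendsto_0 by (rule order_tendstoD) simp
  \<comment> \<open>The border between the two ranges depends on \<open>d\<close> alone, so
    \<open>n ^ J\<close> is a fixed power as \<open>n\<close> grows.\<close>
  then obtain J where J: "\<And>j. j \<ge> J \<Longrightarrow> small_ball j < 2 powr (-4 / d)"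
    unfolding eventually_sequentially by blast
  define B where "B n = real n ^ J * real n ^ J * (2 ^ J * ((4 / 3) ^ J * (3 / 4) ^ n))" for n
  have "(\<lambda>n. real n * (1 / 2) ^ n + (2 ^ J * (4 / 3) ^ J) * (real n ^ Suc (2 * J) * (3 / 4) ^ n))
      \<longlonglongrightarrow> 0 + (2 ^ J * (4 / 3) ^ J) * 0"
    by (intro tendsto_add tendsto_mult tendsto_const polynomial_times_geometric_tendsto_0
        powser_times_n_limit_0) auto
  also have "(\<lambda>n. real n * (1 / 2) ^ n + (2 ^ J * (4 / 3) ^ J) * (real n ^ Suc (2 * J) * (3 / 4) ^ n))
      = (\<lambda>n. real n * ((1 / 2) ^ n + B n))"
    by (rule ext) (simp add: B_def algebra_simps power_add mult_2 mult_2_right)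
  finally have lim: "(\<lambda>n. real n * ((1 / 2) ^ n + B n)) \<longlonglongrightarrow> 0" by simp
  have "\<forall>\<^sub>F n in sequentially. real n * ((1 / 2) ^ n + B n) < 1 / 2"
    using lim by (rule order_tendstoD) simp
  then show ?thesis using eventually_ge_at_top[of 1]
  proof eventually_elim
    case (elim n)
    show ?case
    proof (intro allI impI)
      fix k assume k: "real k \<le> (1 - d) * real n"
      have "(1 - d) * real n \<le> 1 * real n" using assms by (intro mult_right_mono) auto
      then have kn: "k \<le> n" using k by linarith
      have B0: "0 \<le> B n" by (simp add: B_def)
      have "(\<Sum>j=2..k. real (k choose j) * real (n choose j) * (2 ^ j * small_ball j ^ (n - j)))
          \<le> (\<Sum>j=2..k. (1 / 2) ^ n + B n)"
      proof (rule sum_mono)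
        fix j assume j: "j \<in> {2..k}"
        show "real (k choose j) * real (n choose j) * (2 ^ j * small_ball j ^ (n - j)) \<le> (1 / 2) ^ n + B n"
        proof (cases "j \<le> J")
          case True
          have "real (k choose j) * real (n choose j) * (2 ^ j * small_ball j ^ (n - j)) \<le> B n"
            unfolding B_def by (rule collapse_term_le_of_small) (use True j kn elim in auto)
          then show ?thesis by (simp add: add_increasing)
        next
          case False
          then have "small_ball j \<le> 2 powr (-4 / d)" using J[of j] by simp
          then have "real (k choose j) * real (n choose j) * (2 ^ j * small_ball j ^ (n - j)) \<le> (1 / 2) ^ n"
            by (rule collapse_term_le_of_large) (use j k kn assms in auto)
          then show ?thesis using B0 by linarith
        qed
      qed
      also have "\<dots> = real (card {2..k}) * ((1 / 2) ^ n + B n)" by simp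
      also have "\<dots> \<le> real n * ((1 / 2) ^ n + B n)"
        using kn B0 by (intro mult_right_mono) auto
      finally show "(\<Sum>j=2..k. real (k choose j) * real (n choose j) * (2 ^ j * small_ball j ^ (n - j))) \<le> 1 / 2"
        using elim by linarith
    qed
  qed
qed

section \<open>Extremal supports: the upper bound\<close>

definition val :: "(nat \<Rightarrow> nat) \<Rightarrow> nat \<Rightarrow> real" where
  "val \<alpha> i = 1 - 2 * real (\<alpha> i)"

definition neg :: "nat \<Rightarrow> (nat \<Rightarrow> nat) \<Rightarrow> (nat \<Rightarrow> nat)" where
  "neg d \<alpha> = (\<lambda>i\<in>{1..d}. 1 - \<alpha> i)"

lemma idx_cases: "\<alpha> \<in> idx d \<Longrightarrow> i \<in> {1..d} \<Longrightarrow> \<alpha> i = 0 \<or> \<alpha> i = 1"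
  unfolding idx_def by (auto dest!: PiE_mem)

lemma abs_val: "\<alpha> \<in> idx d \<Longrightarrow> i \<in> {1..d} \<Longrightarrow> \<bar>val \<alpha> i\<bar> = 1"
  using idx_cases[of \<alpha> d i] by (auto simp: val_def)

lemma idx_eqI:
  assumes "\<alpha> \<in> idx d" "\<beta> \<in> idx d" "\<And>i. i \<in> {1..d} \<Longrightarrow> val \<alpha> i = val \<beta> i"
  shows "\<alpha> = \<beta>"
  using assms unfolding idx_def by (intro PiE_ext[of \<alpha> "{1..d}" _ \<beta>]) (auto simp: val_def)

lemma neg_in_idx: "\<alpha> \<in> idx d \<Longrightarrow> neg d \<alpha> \<in> idx d"
  unfolding idx_def neg_def by (auto simp: PiE_iff extensional_def)

lemma val_neg: "\<alpha> \<in> idx d \<Longrightarrow> i \<in> {1..d} \<Longrightarrow> val (neg d \<alpha>) i = - val \<alpha> i"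
  using idx_cases[of \<alpha> d i] by (auto simp: val_def neg_def)

lemma finite_idx: "finite (idx d)"
  unfolding idx_def by (intro finite_PiE) auto

lemma card_idx: "card (idx d) = 2 ^ d"
  unfolding idx_def by (simp add: card_PiE numeral_2_eq_2)

lemma support_subset: "support d A \<subseteq> idx d"
  unfolding support_def by auto

lemma finite_support: "finite (support d A)"
  using finite_idx support_subset by (rule finite_subset[rotated])

lemma support_upd: "\<alpha> \<in> idx d \<Longrightarrow> support d (A(\<alpha> := 1)) = insert \<alpha> (support d A)"
  unfolding support_def by auto

lemma sum_hyperplanes:
  fixes w :: "(nat \<Rightarrow> nat) \<Rightarrow> real"
  assumes "i \<in> {1..d}"
  shows "(\<Sum>\<alpha>\<in>support d A. w \<alpha>) =
      (\<Sum>\<alpha>\<in>support d A \<inter> hyperplane d i 0. w \<alpha>) + (\<Sum>\<alpha>\<in>support d A \<inter> hyperplane d i 1. w \<alpha>)"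
    and "(\<Sum>\<alpha>\<in>support d A. w \<alpha> * val \<alpha> i) =
      (\<Sum>\<alpha>\<in>support d A \<inter> hyperplane d i 0. w \<alpha>) - (\<Sum>\<alpha>\<in>support d A \<inter> hyperplane d i 1. w \<alpha>)"
proof -
  let ?S = "\<lambda>j. support d A \<inter> hyperplane d i j"
  have S: "support d A = ?S 0 \<union> ?S 1"
    using idx_cases[OF _ assms] support_subset[of d A] unfolding hyperplane_def by blast
  have split: "(\<Sum>\<alpha>\<in>support d A. g \<alpha>) = (\<Sum>\<alpha>\<in>?S 0. g \<alpha>) + (\<Sum>\<alpha>\<in>?S 1. g \<alpha>)" for g :: "_ \<Rightarrow> real"
    by (subst S, rule sum.union_disjoint) (use finite_support in \<open>auto simp: hyperplane_def\<close>)
  show "(\<Sum>\<alpha>\<in>support d A. w \<alpha>) = (\<Sum>\<alpha>\<in>?S 0. w \<alpha>) + (\<Sum>\<alpha>\<in>?S 1. w \<alpha>)" by (rule split)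
  have "(\<Sum>\<alpha>\<in>?S 0. w \<alpha> * val \<alpha> i) = (\<Sum>\<alpha>\<in>?S 0. w \<alpha>)"
    by (rule sum.cong) (auto simp: hyperplane_def val_def)
  moreover have "(\<Sum>\<alpha>\<in>?S 1. w \<alpha> * val \<alpha> i) = - (\<Sum>\<alpha>\<in>?S 1. w \<alpha>)"
    unfolding sum_negf[symmetric] by (rule sum.cong) (auto simp: hyperplane_def val_def)
  ultimately show "(\<Sum>\<alpha>\<in>support d A. w \<alpha> * val \<alpha> i) = (\<Sum>\<alpha>\<in>?S 0. w \<alpha>) - (\<Sum>\<alpha>\<in>?S 1. w \<alpha>)"
    unfolding split by simp
qed

text \<open>The total is 2 because any one direction splits the support into two hyperplanes of
  weight 1; the difference of these weights is the coordinate of the weighted sum.\<close>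

lemma polydiagonalD:
  assumes "polydiagonal d A w" "1 \<le> d"
  shows "\<alpha> \<in> support d A \<Longrightarrow> 0 \<le> w \<alpha>" "(\<Sum>\<alpha>\<in>support d A. w \<alpha>) = 2"
    "i \<in> {1..d} \<Longrightarrow> (\<Sum>\<alpha>\<in>support d A. w \<alpha> * val \<alpha> i) = 0"
proof -
  have h: "(\<Sum>\<alpha>\<in>support d A \<inter> hyperplane d i j. w \<alpha>) = 1" if "i \<in> {1..d}" "j \<in> {0, 1}" for i j
    using assms(1) that unfolding polydiagonal_def by blast
  show "\<alpha> \<in> support d A \<Longrightarrow> 0 \<le> w \<alpha>" using assms(1) unfolding polydiagonal_def by blast
  have one: "1 \<in> {1..d}" using assms(2) by simp
  show "(\<Sum>\<alpha>\<in>support d A. w \<alpha>) = 2"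
    unfolding sum_hyperplanes(1)[OF one] by (simp add: h[OF one] del: One_nat_def)
  show "i \<in> {1..d} \<Longrightarrow> (\<Sum>\<alpha>\<in>support d A. w \<alpha> * val \<alpha> i) = 0"
    by (subst sum_hyperplanes(2)) (simp_all add: h del: One_nat_def)
qed

text \<open>Any nonzero balanced weighting will do: balance makes parallel hyperplanes equally
  heavy, and rescaling to total 2 makes them weigh 1.\<close>

lemma polydiagonalI:
  assumes nn: "\<And>\<alpha>. \<alpha> \<in> support d A \<Longrightarrow> 0 \<le> w \<alpha>" and pos: "0 < (\<Sum>\<alpha>\<in>support d A. w \<alpha>)"
    and zero: "\<And>i. i \<in> {1..d} \<Longrightarrow> (\<Sum>\<alpha>\<in>support d A. w \<alpha> * val \<alpha> i) = 0"
  shows "\<exists>w. polydiagonal d A w"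
proof -
  define s where "s = (\<Sum>\<alpha>\<in>support d A. w \<alpha>)"
  have s: "0 < s" using pos by (simp add: s_def)
  have "polydiagonal d A (\<lambda>\<alpha>. 2 * w \<alpha> / s)"
    unfolding polydiagonal_def
  proof (intro conjI ballI)
    fix \<alpha> assume "\<alpha> \<in> support d A"
    then show "0 \<le> 2 * w \<alpha> / s" using nn s by simp
  next
    fix i j assume i: "i \<in> {1..d}" and j: "j \<in> {0, 1 :: nat}"
    have "2 * (\<Sum>\<alpha>\<in>support d A \<inter> hyperplane d i j. w \<alpha>) = s"
      using j sum_hyperplanes[OF i, where A = A and w = w] zero[OF i] unfolding s_def by auto
    then show "(\<Sum>\<alpha>\<in>support d A \<inter> hyperplane d i j. 2 * w \<alpha> / s) = 1"
      using s by (simp add: sum_divide_distrib[symmetric] sum_distrib_left[symmetric])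
  qed
  then show ?thesis by blast
qed

text \<open>Stated for a family \<open>\<beta>\<close> that may repeat vertices, so that vertices
  replaced by antipodes need no check for coincidences; weights landing on one vertex are added
  up.\<close>

lemma no_polydiagonal_imp_zero:
  assumes no: "\<nexists>w. polydiagonal d A w" and J: "finite J" "\<beta> ` J \<subseteq> support d A"
    and nn: "\<And>j. j \<in> J \<Longrightarrow> 0 \<le> a j"
    and zero: "\<And>i. i \<in> {1..d} \<Longrightarrow> (\<Sum>j\<in>J. a j * val (\<beta> j) i) = 0"
    and j: "j \<in> J"
  shows "a j = 0"
proof (rule ccontr)
  assume "a j \<noteq> 0"
  then have "0 < a j" using nn[OF j] by simp
  then have pos: "0 < (\<Sum>j\<in>J. a j)" using J(1) j nn by (intro sum_pos2[of J j]) auto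
  define w where "w \<alpha> = (\<Sum>j | j \<in> J \<and> \<beta> j = \<alpha>. a j)" for \<alpha>
  have grp: "(\<Sum>\<alpha>\<in>support d A. \<Sum>j | j \<in> J \<and> \<beta> j = \<alpha>. g j) = (\<Sum>j\<in>J. g j)" for g :: "_ \<Rightarrow> real"
    by (rule sum.group) (use J finite_support in auto)
  have "\<exists>w. polydiagonal d A w"
  proof (rule polydiagonalI)
    show "0 \<le> w \<alpha>" if "\<alpha> \<in> support d A" for \<alpha> unfolding w_def using nn by (intro sum_nonneg) auto
    show "0 < (\<Sum>\<alpha>\<in>support d A. w \<alpha>)" unfolding w_def grp by (rule pos)
    show "(\<Sum>\<alpha>\<in>support d A. w \<alpha> * val \<alpha> i) = 0" if i: "i \<in> {1..d}" for i
    proof -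
      have "w \<alpha> * val \<alpha> i = (\<Sum>j | j \<in> J \<and> \<beta> j = \<alpha>. a j * val (\<beta> j) i)" for \<alpha>
        unfolding w_def sum_distrib_right by (rule sum.cong) auto
      then show ?thesis using grp[of "\<lambda>j. a j * val (\<beta> j) i"] zero[OF i] by simp
    qed
  qed
  then show False using no by simp
qed

text \<open>Both antipodes together would balance each other. If both were missing, the
  polydiagonals obtained by adding either one could be combined so that the two new vertices cancel,
  leaving balanced weights on the old support; these must vanish, and then a single vertex would
  have to balance itself.\<close>

lemma extremal_self_dual:
  assumes ext: "extremal d A" and d: "1 \<le> d" and al: "\<alpha> \<in> idx d"
  shows "neg d \<alpha> \<in> support d A \<longleftrightarrow> \<alpha> \<notin> support d A"
proof -
  have no: "\<nexists>w. polydiagonal d A w" using ext by (simp add: extremal_def)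
  let ?S = "support d A" let ?n = "neg d \<alpha>"
  have one: "1 \<in> {1..d}" using d by simp
  have "\<not> (\<alpha> \<in> ?S \<and> ?n \<in> ?S)"
  proof
    assume h: "\<alpha> \<in> ?S \<and> ?n \<in> ?S"
    have "(1::real) = 0"
      by (rule no_polydiagonal_imp_zero[OF no, of "UNIV :: bool set" "\<lambda>b. if b then \<alpha> else ?n" "\<lambda>_. 1" True])
        (use h al in \<open>auto simp: UNIV_bool val_neg\<close>)
    then show False by simp
  qed
  moreover have "\<alpha> \<in> ?S \<or> ?n \<in> ?S"
  proof (rule ccontr)
    assume h: "\<not> (\<alpha> \<in> ?S \<or> ?n \<in> ?S)"
    have "\<exists>w. polydiagonal d (A(\<beta> := 1)) w" if "\<beta> \<in> idx d - ?S" for \<beta>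
      using ext that unfolding extremal_def by blast
    then obtain w w' where w: "polydiagonal d (A(\<alpha> := 1)) w" and w': "polydiagonal d (A(?n := 1)) w'"
      using h al neg_in_idx[OF al] by (meson DiffI)
    note wD = polydiagonalD[OF w d, unfolded support_upd[OF al]]
    note wD' = polydiagonalD[OF w' d, unfolded support_upd[OF neg_in_idx[OF al]]]
    have tot: "w \<alpha> + sum w ?S = 2" "w' ?n + sum w' ?S = 2"
      using wD(2) wD'(2) h finite_support[of d A] by simp_all
    have bal: "w \<alpha> * val \<alpha> i + (\<Sum>\<gamma>\<in>?S. w \<gamma> * val \<gamma> i) = 0"
      "(\<Sum>\<gamma>\<in>?S. w' \<gamma> * val \<gamma> i) = w' ?n * val \<alpha> i" if "i \<in> {1..d}" for i
      using wD(3)[OF that] wD'(3)[OF that] h finite_support[of d A] val_neg[OF al that] by simp_all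
    have nn: "0 \<le> w \<gamma>" "0 \<le> w' \<gamma>" if "\<gamma> \<in> ?S" for \<gamma> using wD(1) wD'(1) that by simp_all
    have nn': "0 \<le> w \<alpha>" "0 \<le> w' ?n" using wD(1) wD'(1) by simp_all
    have imp: "\<forall>\<gamma>\<in>?S. g \<gamma> = 0" if "\<And>\<gamma>. \<gamma> \<in> ?S \<Longrightarrow> 0 \<le> g \<gamma>"
      "\<And>i. i \<in> {1..d} \<Longrightarrow> (\<Sum>\<gamma>\<in>?S. g \<gamma> * val \<gamma> i) = 0" for g
    proof
      fix \<gamma> assume "\<gamma> \<in> ?S"
      then show "g \<gamma> = 0"
        using no_polydiagonal_imp_zero[OF no finite_support[of d A], of "\<lambda>x. x" g] that by simp
    qed
    have wpos: "w \<alpha> \<noteq> 0"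
    proof
      assume 0: "w \<alpha> = 0"
      then have "\<forall>\<gamma>\<in>?S. w \<gamma> = 0" using bal(1) nn(1) by (intro imp) simp_all
      then show False using tot(1) 0 by simp
    qed
    have wpos': "w' ?n \<noteq> 0"
    proof
      assume 0: "w' ?n = 0"
      then have "\<forall>\<gamma>\<in>?S. w' \<gamma> = 0" using bal(2) nn(2) by (intro imp) simp_all
      then show False using tot(2) 0 by simp
    qed
    \<comment> \<open>Cross multiplication by the weights of the two new vertices makes their
      contributions cancel.\<close>
    have "\<forall>\<gamma>\<in>?S. w' ?n * w \<gamma> + w \<alpha> * w' \<gamma> = 0"
    proof (rule imp)
      show "0 \<le> w' ?n * w \<gamma> + w \<alpha> * w' \<gamma>" if "\<gamma> \<in> ?S" for \<gamma> using nn[OF that] nn' by simp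
      show "(\<Sum>\<gamma>\<in>?S. (w' ?n * w \<gamma> + w \<alpha> * w' \<gamma>) * val \<gamma> i) = 0" if i: "i \<in> {1..d}" for i
      proof -
        have "(\<Sum>\<gamma>\<in>?S. (w' ?n * w \<gamma> + w \<alpha> * w' \<gamma>) * val \<gamma> i) =
            w' ?n * (\<Sum>\<gamma>\<in>?S. w \<gamma> * val \<gamma> i) + w \<alpha> * (\<Sum>\<gamma>\<in>?S. w' \<gamma> * val \<gamma> i)"
          by (simp add: sum.distrib sum_distrib_left algebra_simps)
        also have "(\<Sum>\<gamma>\<in>?S. w \<gamma> * val \<gamma> i) = - (w \<alpha> * val \<alpha> i)" using bal(1)[OF i] by simp
        also have "(\<Sum>\<gamma>\<in>?S. w' \<gamma> * val \<gamma> i) = w' ?n * val \<alpha> i" by (rule bal(2)[OF i])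
        finally show ?thesis by simp
      qed
    qed
    then have "\<forall>\<gamma>\<in>?S. w \<gamma> = 0"
      using nn nn' wpos wpos' by (simp add: add_nonneg_eq_0_iff)
    then have "(\<Sum>\<gamma>\<in>?S. w \<gamma> * val \<gamma> 1) = 0" by (intro sum.neutral) simp
    then have "w \<alpha> * val \<alpha> 1 = 0" using bal(1)[OF one] by simp
    then show False using wpos abs_val[OF al one] by simp
  qed
  ultimately show ?thesis by blast
qed

text \<open>More than \<open>d\<close> vertices satisfy a linear relation, and no extremal support
  can have the positive part of that relation as its trace.\<close>

lemma card_shattered_by_extremal_le:
  assumes d: "1 \<le> d" and C: "C \<subseteq> idx d" "shatters (support d ` {A. extremal d A}) C"
  shows "card C \<le> d"
proof (rule ccontr)
  assume gt: "\<not> card C \<le> d"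
  have finC: "finite C" using C(1) finite_idx by (rule finite_subset)
  have "\<exists>R\<subseteq>C. card R \<le> card {1..d} \<and> (\<forall>t\<in>C. \<exists>c. \<forall>i\<in>{1..d}. val t i = (\<Sum>s\<in>R. c s * val s i))"
    by (rule spanning_subfamily) (use finC in auto)
  then obtain R where R: "R \<subseteq> C" "card R \<le> card {1..d}"
    "\<forall>t\<in>C. \<exists>c. \<forall>i\<in>{1..d}. val t i = (\<Sum>s\<in>R. c s * val s i)" by (elim exE conjE)
  have "R \<noteq> C" using gt R(2) by auto
  then obtain \<gamma> where g: "\<gamma> \<in> C" "\<gamma> \<notin> R" using R(1) by blast
  obtain c where c: "\<forall>i\<in>{1..d}. val \<gamma> i = (\<Sum>s\<in>R. c s * val s i)"
    using bspec[OF R(3) g(1)] by (elim exE)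
  \<comment> \<open>The relation: \<open>\<gamma>\<close> is a combination of \<open>R\<close>,
    moved to one side with coefficient -1, so it is nontrivial.\<close>
  define b where "b s = (if s = \<gamma> then -1 else if s \<in> R then c s else 0)" for s
  define C' where "C' = {s\<in>C. b s \<noteq> 0}"
  have bz: "(\<Sum>s\<in>C'. b s * val s i) = 0" if i: "i \<in> {1..d}" for i
  proof -
    have finR: "finite R" using finC R(1) by (rule finite_subset[rotated])
    have "(\<Sum>s\<in>C'. b s * val s i) = (\<Sum>s\<in>C. b s * val s i)"
      unfolding C'_def by (rule sum.mono_neutral_left) (use finC in auto)
    also have "\<dots> = (\<Sum>s\<in>insert \<gamma> R. b s * val s i)"
      by (rule sum.mono_neutral_right) (use finC R(1) g in \<open>auto simp: b_def\<close>)
    also have "\<dots> = b \<gamma> * val \<gamma> i + (\<Sum>s\<in>R. b s * val s i)"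
      using finR g(2) by (rule sum.insert)
    also have "(\<Sum>s\<in>R. b s * val s i) = (\<Sum>s\<in>R. c s * val s i)"
      by (rule sum.cong) (use g in \<open>auto simp: b_def\<close>)
    also have "\<dots> = val \<gamma> i" by (rule bspec[OF c i, symmetric])
    finally show ?thesis by (simp add: b_def)
  qed
  define D where "D = {s\<in>C. 0 < b s}"
  have "D \<subseteq> C" by (auto simp: D_def)
  then obtain A where A: "extremal d A" "support d A \<inter> C = D"
    using C(2) unfolding shatters_def by blast
  have no: "\<nexists>w. polydiagonal d A w" using A(1) by (simp add: extremal_def)
  have "\<bar>b \<gamma>\<bar> = 0"
  proof (rule no_polydiagonal_imp_zero[OF no, of C' "\<lambda>s. if 0 < b s then s else neg d s" "\<lambda>s. \<bar>b s\<bar>"])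
    show "finite C'" unfolding C'_def using finC by simp
    show "(\<lambda>s. if 0 < b s then s else neg d s) ` C' \<subseteq> support d A"
    proof (rule image_subsetI)
      fix s assume "s \<in> C'"
      then have s: "s \<in> C" "b s \<noteq> 0" "s \<in> idx d" using C(1) by (auto simp: C'_def)
      have "s \<in> support d A \<longleftrightarrow> 0 < b s" using A(2) s by (auto simp: D_def)
      then show "(if 0 < b s then s else neg d s) \<in> support d A"
        using extremal_self_dual[OF A(1) d s(3)] by auto
    qed
    show "(\<Sum>s\<in>C'. \<bar>b s\<bar> * val (if 0 < b s then s else neg d s) i) = 0" if i: "i \<in> {1..d}" for i
    proof -
      have "(\<Sum>s\<in>C'. \<bar>b s\<bar> * val (if 0 < b s then s else neg d s) i) = (\<Sum>s\<in>C'. b s * val s i)"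
        by (rule sum.cong) (use C(1) i in \<open>auto simp: C'_def val_neg subset_iff\<close>)
      then show ?thesis using bz[OF i] by simp
    qed
    show "\<gamma> \<in> C'" using g by (simp add: C'_def b_def)
  qed simp
  then show False by (simp add: b_def)
qed

lemma card_small_subsets_le:
  assumes "finite X"
  shows "card {C. C \<subseteq> X \<and> card C \<le> n} \<le> (card X + 1) ^ n"
proof (induction n)
  case 0
  have "{C. C \<subseteq> X \<and> card C \<le> 0} = {{}}" using assms by (auto dest: finite_subset)
  then show ?case by simp
next
  case (Suc n)
  let ?P = "\<lambda>n. {C. C \<subseteq> X \<and> card C \<le> n}"
  \<comment> \<open>Each step adds an element or, with \<open>None\<close>, nothing:
    \<open>card X + 1\<close> options, which also reach the empty set.\<close>
  let ?f = "\<lambda>(C, x). case x of None \<Rightarrow> C | Some x \<Rightarrow> insert x C"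
  let ?Y = "insert None (Some ` X)"
  have fin: "finite (?P n \<times> ?Y)" using assms by simp
  have "?P (Suc n) \<subseteq> ?f ` (?P n \<times> ?Y)"
  proof
    fix C assume C: "C \<in> ?P (Suc n)"
    have finC: "finite C" using C assms by (auto dest: finite_subset)
    show "C \<in> ?f ` (?P n \<times> ?Y)"
    proof (cases "C = {}")
      case True
      then show ?thesis by (intro image_eqI[of _ _ "({}, None)"]) auto
    next
      case False
      then obtain x where x: "x \<in> C" by blast
      then show ?thesis using C finC by (intro image_eqI[of _ _ "(C - {x}, Some x)"]) auto
    qed
  qed
  then have "card (?P (Suc n)) \<le> card (?P n \<times> ?Y)" using fin by (meson card_image_le card_mono finite_imageI le_trans)
  also have "\<dots> = card (?P n) * (card X + 1)"
    using assms by (simp add: card_cartesian_product card_image)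
  also have "\<dots> \<le> (card X + 1) ^ n * (card X + 1)" by (rule mult_right_mono[OF Suc.IH]) simp
  finally show ?case by (simp add: mult.commute)
qed

lemma inj_on_support: "inj_on (support d) {A. extremal d A}"
proof (rule inj_onI)
  fix A B assume h: "A \<in> {A. extremal d A}" "B \<in> {A. extremal d A}" "support d A = support d B"
  then have "A \<in> idx d \<rightarrow>\<^sub>E {0, 1}" "B \<in> idx d \<rightarrow>\<^sub>E {0, 1}"
    by (auto simp: extremal_def matrices_def)
  then show "A = B"
  proof (rule PiE_ext)
    fix \<alpha> assume al: "\<alpha> \<in> idx d"
    have "A \<alpha> = 1 \<longleftrightarrow> B \<alpha> = 1" using h(3) al unfolding support_def by blast
    moreover have "A \<alpha> \<in> {0, 1}" "B \<alpha> \<in> {0, 1}"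
      using \<open>A \<in> idx d \<rightarrow>\<^sub>E {0, 1}\<close> \<open>B \<in> idx d \<rightarrow>\<^sub>E {0, 1}\<close> al by (auto dest!: PiE_mem)
    ultimately show "A \<alpha> = B \<alpha>" by auto
  qed
qed

lemma finite_extremal: "finite {A. extremal d A}"
proof (rule finite_subset)
  show "{A. extremal d A} \<subseteq> idx d \<rightarrow>\<^sub>E {0, 1}" by (auto simp: extremal_def matrices_def)
  show "finite (idx d \<rightarrow>\<^sub>E {0, 1 :: nat})" by (intro finite_PiE finite_idx) auto
qed

lemma card_extremal_le:
  assumes "1 \<le> d"
  shows "card {A. extremal d A} \<le> (2 ^ d + 1) ^ d"
proof -
  let ?F = "support d ` {A. extremal d A}"
  have "card {A. extremal d A} = card ?F" using inj_on_support by (simp add: card_image)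
  also have "\<dots> \<le> card {C. C \<subseteq> idx d \<and> shatters ?F C}"
    by (rule card_le_card_shattered[OF finite_idx]) (use support_subset in blast)
  also have "\<dots> \<le> card {C. C \<subseteq> idx d \<and> card C \<le> d}"
    using card_shattered_by_extremal_le[OF assms] finite_idx by (intro card_mono) auto
  also have "\<dots> \<le> (2 ^ d + 1) ^ d" using card_small_subsets_le[OF finite_idx, of d d] by (simp add: card_idx)
  finally show ?thesis .
qed

section \<open>Halfspaces: the lower bound\<close>

definition ip :: "nat \<Rightarrow> (nat \<Rightarrow> real) \<Rightarrow> (nat \<Rightarrow> nat) \<Rightarrow> real" where
  "ip d l \<alpha> = (\<Sum>i\<in>{1..d}. l i * val \<alpha> i)"

definition halfspace :: "nat \<Rightarrow> (nat \<Rightarrow> real) \<Rightarrow> (nat \<Rightarrow> nat) \<Rightarrow> nat" where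
  "halfspace d l = (\<lambda>\<alpha>\<in>idx d. if 0 < ip d l \<alpha> then 1 else 0)"

lemma support_halfspace: "support d (halfspace d l) = {\<alpha> \<in> idx d. 0 < ip d l \<alpha>}"
  by (auto simp: support_def halfspace_def)

lemma ip_neg: "\<alpha> \<in> idx d \<Longrightarrow> ip d l (neg d \<alpha>) = - ip d l \<alpha>"
  unfolding ip_def sum_negf[symmetric] by (rule sum.cong) (auto simp: val_neg)

lemma ip_add_scaled: "ip d (\<lambda>i. l i + e * m i) \<alpha> = ip d l \<alpha> + e * ip d m \<alpha>"
  by (simp add: ip_def algebra_simps sum.distrib sum_distrib_left)

text \<open>Balanced weights would make a positive linear functional average to 0. A missing vertex
  is strictly negative, so its antipode is present and the pair alone is balanced.\<close>

lemma extremal_halfspace: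
  assumes d: "1 \<le> d" and nz: "\<And>\<alpha>. \<alpha> \<in> idx d \<Longrightarrow> ip d l \<alpha> \<noteq> 0"
  shows "extremal d (halfspace d l)"
  unfolding extremal_def
proof (intro conjI ballI notI)
  let ?S = "support d (halfspace d l)"
  show "halfspace d l \<in> matrices d" by (auto simp: matrices_def halfspace_def)
  show False if ex: "\<exists>w. polydiagonal d (halfspace d l) w"
  proof -
    obtain w where w: "polydiagonal d (halfspace d l) w" using ex by blast
    note wD = polydiagonalD[OF w d]
    have "(\<Sum>\<alpha>\<in>?S. w \<alpha> * ip d l \<alpha>) = (\<Sum>\<alpha>\<in>?S. \<Sum>i\<in>{1..d}. l i * (w \<alpha> * val \<alpha> i))"
      by (simp add: ip_def sum_distrib_left mult.left_commute)
    also have "\<dots> = (\<Sum>i\<in>{1..d}. l i * (\<Sum>\<alpha>\<in>?S. w \<alpha> * val \<alpha> i))"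
      by (subst sum.swap) (simp add: sum_distrib_left)
    also have "\<dots> = 0" by (rule sum.neutral) (simp add: wD(3))
    finally have "(\<Sum>\<alpha>\<in>?S. w \<alpha> * ip d l \<alpha>) = 0" .
    moreover have pos: "0 < ip d l \<alpha>" if "\<alpha> \<in> ?S" for \<alpha> using that by (simp add: support_halfspace)
    ultimately have "\<forall>\<alpha>\<in>?S. w \<alpha> * ip d l \<alpha> = 0"
      using wD(1) finite_support by (subst (asm) sum_nonneg_eq_0_iff) (auto simp: less_imp_le)
    then have "\<forall>\<alpha>\<in>?S. w \<alpha> = 0" using pos by fastforce
    then show False using wD(2) by simp
  qed
  fix \<alpha> assume al: "\<alpha> \<in> idx d - ?S"
  then have a: "\<alpha> \<in> idx d" "ip d l \<alpha> < 0" using nz[of \<alpha>] by (auto simp: support_halfspace)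
  then have n: "neg d \<alpha> \<in> ?S" by (simp add: support_halfspace neg_in_idx ip_neg)
  then have ne: "neg d \<alpha> \<noteq> \<alpha>" using al by auto
  define w :: "(nat \<Rightarrow> nat) \<Rightarrow> real" where "w \<gamma> = (if \<gamma> \<in> {\<alpha>, neg d \<alpha>} then 1 else 0)" for \<gamma>
  have su: "support d ((halfspace d l)(\<alpha> := 1)) = insert \<alpha> ?S" by (rule support_upd[OF a(1)])
  have sums: "(\<Sum>\<gamma>\<in>insert \<alpha> ?S. w \<gamma> * g \<gamma>) = g \<alpha> + g (neg d \<alpha>)" for g
  proof -
    have "(\<Sum>\<gamma>\<in>insert \<alpha> ?S. w \<gamma> * g \<gamma>) = (\<Sum>\<gamma>\<in>{\<alpha>, neg d \<alpha>}. g \<gamma>)"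
      by (rule sum.mono_neutral_cong_right) (use n finite_support in \<open>auto simp: w_def\<close>)
    then show ?thesis using ne by simp
  qed
  show "\<exists>w. polydiagonal d ((halfspace d l)(\<alpha> := 1)) w"
  proof (rule polydiagonalI[of _ _ w], unfold su)
    show "0 < sum w (insert \<alpha> ?S)" using sums[of "\<lambda>_. 1"] by simp
    show "(\<Sum>\<gamma>\<in>insert \<alpha> ?S. w \<gamma> * val \<gamma> i) = 0" if "i \<in> {1..d}" for i
      using sums[of "\<lambda>\<gamma>. val \<gamma> i"] val_neg[OF a(1) that] by simp
  qed (simp add: w_def)
qed

text \<open>By continuity each nonzero value keeps its sign for small \<open>e\<close>, and finitely
  many vertices admit a common \<open>e\<close>.\<close>

lemma sgn_ip_perturb:
  assumes "finite Y" "\<And>y. y \<in> Y \<Longrightarrow> ip d l y \<noteq> 0"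
  shows "\<exists>e>0. \<forall>y\<in>Y. sgn (ip d (\<lambda>i. l i + e * m i) y) = sgn (ip d l y)"
proof -
  have "\<forall>\<^sub>F e in at_right 0. \<forall>y\<in>Y. sgn (ip d (\<lambda>i. l i + e * m i) y) = sgn (ip d l y)"
  proof (rule eventually_ball_finite[OF assms(1)], intro ballI)
    fix y assume y: "y \<in> Y"
    have "((\<lambda>e. ip d l y + e * ip d m y) \<longlongrightarrow> ip d l y + 0 * ip d m y) (at_right 0)"
      by (intro tendsto_intros)
    then have lim: "((\<lambda>e. ip d (\<lambda>i. l i + e * m i) y) \<longlongrightarrow> ip d l y) (at_right 0)"
      by (simp add: ip_add_scaled)
    consider "ip d l y < 0" | "0 < ip d l y" using assms(2)[OF y] by linarith
    then show "\<forall>\<^sub>F e in at_right 0. sgn (ip d (\<lambda>i. l i + e * m i) y) = sgn (ip d l y)"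
    proof cases
      case 1
      show ?thesis using order_tendstoD(2)[OF lim 1] by eventually_elim (use 1 in simp)
    next
      case 2
      show ?thesis using order_tendstoD(1)[OF lim 2] by eventually_elim (use 2 in simp)
    qed
  qed
  then have "\<forall>\<^sub>F e in at_right 0. 0 < e \<and> (\<forall>y\<in>Y. sgn (ip d (\<lambda>i. l i + e * m i) y) = sgn (ip d l y))"
    by (intro eventually_conj eventually_at_right_less)
  then show ?thesis using eventually_happens'[OF trivial_limit_at_right_real] by blast
qed

text \<open>A real vector space is not a finite union of proper subspaces, proved here by repairing
  one vertex at a time with a small perturbation inside the annihilator of \<open>R\<close>.\<close>

lemma generic_annihilator:
  assumes "finite Y" "\<And>y. y \<in> Y \<Longrightarrow> \<exists>l. (\<forall>s\<in>R. ip d l s = 0) \<and> ip d l y \<noteq> 0"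
  shows "\<exists>l. (\<forall>s\<in>R. ip d l s = 0) \<and> (\<forall>y\<in>Y. ip d l y \<noteq> 0)"
  using assms
proof (induction Y rule: finite_induct)
  case empty
  show ?case by (intro exI[of _ "\<lambda>_. 0"]) (simp add: ip_def)
next
  case (insert y Y)
  obtain l where l: "\<forall>s\<in>R. ip d l s = 0" "\<forall>y\<in>Y. ip d l y \<noteq> 0" using insert by blast
  obtain m where m: "\<forall>s\<in>R. ip d m s = 0" "ip d m y \<noteq> 0" using insert.prems by blast
  show ?case
  proof (cases "ip d l y = 0")
    case True
    obtain e where e: "e > 0" "\<forall>y\<in>Y. sgn (ip d (\<lambda>i. l i + e * m i) y) = sgn (ip d l y)"
      using sgn_ip_perturb[OF insert.hyps(1), of d l m] l(2) by blast
    have "ip d (\<lambda>i. l i + e * m i) y \<noteq> 0" using True m e by (simp add: ip_add_scaled)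
    moreover have "ip d (\<lambda>i. l i + e * m i) z \<noteq> 0" if "z \<in> Y" for z
      using e(2) l(2) that by (metis sgn_eq_0_iff)
    moreover have "ip d (\<lambda>i. l i + e * m i) s = 0" if "s \<in> R" for s
      using l(1) m(1) that by (simp add: ip_add_scaled)
    ultimately show ?thesis by (intro exI[of _ "\<lambda>i. l i + e * m i"]) auto
  next
    case False
    then show ?thesis using l by blast
  qed
qed

text \<open>The facet represents every antipodal pair of vertices exactly once.\<close>

definition facet :: "nat \<Rightarrow> (nat \<Rightarrow> nat) set" where
  "facet d = {\<alpha> \<in> idx d. \<alpha> 1 = 0}"

lemma facet_or_neg: "1 \<le> d \<Longrightarrow> \<alpha> \<in> idx d \<Longrightarrow> \<alpha> \<in> facet d \<or> neg d \<alpha> \<in> facet d"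
  using idx_cases[of \<alpha> d 1] neg_in_idx[of \<alpha> d] by (auto simp: facet_def) (simp add: neg_def)

text \<open>For sets in the facet this single condition covers both independence and the absence of
  other facet vertices from the span. The threshold is 2 because one nonzero coefficient only gives
  a vertex or its antipode.\<close>

definition isolated :: "nat \<Rightarrow> (nat \<Rightarrow> nat) set \<Rightarrow> bool" where
  "isolated d C \<longleftrightarrow> \<not> (\<exists>c :: (nat \<Rightarrow> nat) \<Rightarrow> real. 2 \<le> card {\<gamma>\<in>C. c \<gamma> \<noteq> 0} \<and>
     (\<forall>i\<in>{1..d}. \<bar>\<Sum>\<gamma>\<in>C. c \<gamma> * val \<gamma> i\<bar> = 1))"

text \<open>Used with \<open>R = C\<close> and \<open>y\<close> outside \<open>C\<close>, and with
  \<open>y\<close> in \<open>C\<close> removed from \<open>R\<close>. A combination equal to a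
  vertex has only one nonzero coefficient by isolation, and the common first coordinate of the facet
  forces that coefficient to be 1.\<close>

lemma isolated_not_combination:
  assumes d: "1 \<le> d" and C: "C \<subseteq> facet d" "isolated d C" and R: "R \<subseteq> C" and y: "y \<in> facet d" "y \<notin> R"
  shows "\<not> (\<exists>c. \<forall>i\<in>{1..d}. val y i = (\<Sum>s\<in>R. c s * val s i))"
proof
  assume "\<exists>c. \<forall>i\<in>{1..d}. val y i = (\<Sum>s\<in>R. c s * val s i)"
  then obtain c where c: "\<forall>i\<in>{1..d}. val y i = (\<Sum>s\<in>R. c s * val s i)" by (elim exE)
  have one: "1 \<in> {1..d}" using d by simp
  have finC: "finite C" using C(1) finite_idx unfolding facet_def by (auto intro: finite_subset)
  have finR: "finite R" using R finC by (rule finite_subset)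
  define b where "b s = (if s \<in> R then c s else 0)" for s
  define N where "N = {s\<in>C. b s \<noteq> 0}"
  have finN: "finite N" using finC by (simp add: N_def)
  have b: "(\<Sum>s\<in>C. b s * val s i) = val y i" if i: "i \<in> {1..d}" for i
  proof -
    have "(\<Sum>s\<in>C. b s * val s i) = (\<Sum>s\<in>R. c s * val s i)"
      by (rule sum.mono_neutral_cong_right) (use R finC in \<open>auto simp: b_def\<close>)
    also have "\<dots> = val y i" by (rule bspec[OF c i, symmetric])
    finally show ?thesis .
  qed
  have bN: "(\<Sum>s\<in>N. b s * val s i) = val y i" if i: "i \<in> {1..d}" for i
    unfolding b[OF i, symmetric] N_def by (rule sum.mono_neutral_left) (use finC in auto)
  have yi: "y \<in> idx d" "val y 1 = 1" using y by (auto simp: facet_def val_def)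
  have "\<forall>i\<in>{1..d}. \<bar>\<Sum>\<gamma>\<in>C. b \<gamma> * val \<gamma> i\<bar> = 1" using b abs_val[OF yi(1)] by simp
  then have "card N < 2" using C(2) unfolding isolated_def N_def by force
  then consider "card N = 0" | "card N = 1" by linarith
  then show False
  proof cases
    case 1
    then have "N = {}" using finN by simp
    then show False using bN[OF one] yi by simp
  next
    case 2
    then obtain s where s: "N = {s}" by (auto simp: card_1_singleton_iff)
    then have sC: "s \<in> C" "b s \<noteq> 0" by (auto simp: N_def)
    then have sR: "s \<in> R" by (auto simp: b_def split: if_splits)
    have si: "s \<in> idx d" "val s 1 = 1" using sC C(1) by (auto simp: facet_def val_def)
    have "b s = 1" using bN[OF one] s si yi by simp
    then have "val s i = val y i" if "i \<in> {1..d}" for i using bN[OF that] s by simp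
    then have "s = y" using si yi by (intro idx_eqI[of _ d]) auto
    then show False using sR y by simp
  qed
qed

text \<open>\<open>l0\<close> vanishes on \<open>C\<close> and nowhere else on the facet, and its
  signs there fix \<open>B\<close>. The dual functionals \<open>f g\<close> separate the points of
  \<open>C\<close>, so adding a small multiple of their signed sum selects any \<open>D\<close> and
  keeps \<open>B\<close>.\<close>

lemma strongly_shatters_isolated:
  assumes d: "1 \<le> d" and C: "C \<subseteq> facet d" "isolated d C"
  shows "strongly_shatters (facet d) ((\<lambda>A. support d A \<inter> facet d) ` {A. extremal d A}) C"
proof -
  have fin: "finite (facet d)" unfolding facet_def using finite_idx by simp
  have finC: "finite C" using C(1) fin by (rule finite_subset)
  have dual: "\<exists>l. (\<forall>s\<in>R. ip d l s = 0) \<and> ip d l y = 1" if "R \<subseteq> C" "y \<in> facet d" "y \<notin> R" for R y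
  proof -
    have "finite R" using that(1) finC by (rule finite_subset)
    then show ?thesis
      using combination_or_dual_vector[of "{1..d}" R "val y" val] isolated_not_combination[OF d C that]
      unfolding ip_def by (simp only: finite_atLeastAtMost simp_thms)
  qed
  have "\<exists>l. (\<forall>s\<in>C. ip d l s = 0) \<and> (\<forall>y\<in>facet d - C. ip d l y \<noteq> 0)"
  proof (rule generic_annihilator)
    fix y assume "y \<in> facet d - C"
    then show "\<exists>l. (\<forall>s\<in>C. ip d l s = 0) \<and> ip d l y \<noteq> 0" using dual[of C y] by force
  qed (use fin in simp)
  then obtain l0 where l0: "\<forall>s\<in>C. ip d l0 s = 0" "\<forall>y\<in>facet d - C. ip d l0 y \<noteq> 0" by blast
  have "\<forall>g\<in>C. \<exists>l. (\<forall>s\<in>C - {g}. ip d l s = 0) \<and> ip d l g = 1"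
    using dual C(1) by (intro ballI) (rule dual, auto)
  then obtain f where f: "\<And>g s. g \<in> C \<Longrightarrow> s \<in> C - {g} \<Longrightarrow> ip d (f g) s = 0"
    "\<And>g. g \<in> C \<Longrightarrow> ip d (f g) g = 1" by metis
  define B where "B = {y \<in> facet d - C. 0 < ip d l0 y}"
  have "B \<union> D \<in> (\<lambda>A. support d A \<inter> facet d) ` {A. extremal d A}" if D: "D \<subseteq> C" for D
  proof -
    define m where "m i = (\<Sum>g\<in>C. pm D g * f g i)" for i
    have m: "ip d m s = pm D s" if s: "s \<in> C" for s
    proof -
      have "ip d m s = (\<Sum>g\<in>C. pm D g * ip d (f g) s)"
        unfolding ip_def m_def sum_distrib_right sum_distrib_left
        by (subst sum.swap) (simp add: mult.assoc)
      also have "\<dots> = (\<Sum>g\<in>C. if g = s then pm D s else 0)"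
        by (rule sum.cong) (use f s in auto)
      finally show ?thesis using s finC by simp
    qed
    obtain e where e: "e > 0"
      "\<forall>y\<in>facet d - C. sgn (ip d (\<lambda>i. l0 i + e * m i) y) = sgn (ip d l0 y)"
      using sgn_ip_perturb[of "facet d - C" d l0 m] fin l0(2) by blast
    define l where "l i = l0 i + e * m i" for i
    have lC: "ip d l s = e * pm D s" if "s \<in> C" for s
      using that l0(1) m by (simp add: l_def[abs_def] ip_add_scaled)
    have lY: "sgn (ip d l y) = sgn (ip d l0 y)" if "y \<in> facet d - C" for y
      using e(2) that by (simp add: l_def[abs_def])
    have nzf: "ip d l y \<noteq> 0" if "y \<in> facet d" for y
    proof (cases "y \<in> C")
      case True
      then show ?thesis using lC e(1) by (simp add: pm_def)
    next
      case False
      then show ?thesis using lY[of y] l0(2) that by (auto simp: sgn_0_0)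
    qed
    \<comment> \<open>Antipodes carry the statement from the facet to the whole cube, as extremality
      needs.\<close>
    have "ip d l y \<noteq> 0" if "y \<in> idx d" for y
      using facet_or_neg[OF d that] nzf[of y] nzf[of "neg d y"] ip_neg[OF that, of l] by auto
    then have "extremal d (halfspace d l)" by (rule extremal_halfspace[OF d])
    moreover have "support d (halfspace d l) \<inter> facet d = B \<union> D"
    proof -
      have "0 < ip d l y \<longleftrightarrow> y \<in> B \<union> D" if y: "y \<in> facet d" for y
      proof (cases "y \<in> C")
        case True
        then show ?thesis using lC[OF True] e(1) by (auto simp: pm_def B_def)
      next
        case False
        then have "0 < ip d l y \<longleftrightarrow> 0 < ip d l0 y" using lY[of y] y by (metis DiffI sgn_greater)
        then show ?thesis using False y D by (auto simp: B_def)
      qed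
      moreover have "B \<union> D \<subseteq> facet d" using D C(1) by (auto simp: B_def)
      ultimately show ?thesis unfolding support_halfspace by (auto simp: facet_def)
    qed
    ultimately show ?thesis by blast
  qed
  then show ?thesis unfolding strongly_shatters_def B_def by (intro exI[of _ B]) (auto simp: B_def)
qed

lemma card_isolated_le:
  assumes "1 \<le> d"
  shows "card {C. C \<subseteq> facet d \<and> isolated d C} \<le> card {A. extremal d A}"
proof -
  let ?F = "(\<lambda>A. support d A \<inter> facet d) ` {A. extremal d A}"
  have fin: "finite (facet d)" unfolding facet_def using finite_idx by simp
  have "card {C. C \<subseteq> facet d \<and> isolated d C} \<le> card {C. C \<subseteq> facet d \<and> strongly_shatters (facet d) ?F C}"
    using strongly_shatters_isolated[OF assms] fin by (intro card_mono) auto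
  also have "\<dots> \<le> card ?F" by (rule card_strongly_shattered_le[OF fin]) auto
  also have "\<dots> \<le> card {A. extremal d A}" by (rule card_image_le[OF finite_extremal])
  finally show ?thesis .
qed

section \<open>From tuples to sets of vertices\<close>

text \<open>Reads off column \<open>i\<close> of the coordinatewise storage. Coordinate 1 is pinned
  to place the vertex in the facet, which leaves the \<open>d - 1\<close> free coordinates
  \<open>{2..d}\<close>.\<close>

definition vertex :: "nat \<Rightarrow> (nat \<Rightarrow> nat set) \<Rightarrow> nat \<Rightarrow> nat \<Rightarrow> nat" where
  "vertex d r i = (\<lambda>t\<in>{1..d}. if t = 1 \<or> i \<in> r t then 0 else 1)"

lemma vertex_in_facet: "1 \<le> d \<Longrightarrow> vertex d r i \<in> facet d"
  by (auto simp: vertex_def facet_def idx_def)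

lemma val_vertex: "t \<in> {2..d} \<Longrightarrow> val (vertex d r i) t = pm (r t) i"
  by (auto simp: vertex_def val_def pm_def)

text \<open>If two columns coincide, half their sum is a \<plusminus>1 vector with two nonzero
  coefficients.\<close>

lemma inj_on_vertex:
  assumes "finite K" "\<not> collapsing K {2..d} r"
  shows "inj_on (vertex d r) K"
proof (rule inj_onI, rule ccontr)
  fix i j assume h: "i \<in> K" "j \<in> K" "vertex d r i = vertex d r j" "i \<noteq> j"
  define c :: "nat \<Rightarrow> real" where "c x = (if x \<in> {i, j} then 1 / 2 else 0)" for x
  have "{x\<in>K. c x \<noteq> 0} = {i, j}" using h by (auto simp: c_def)
  then have "2 \<le> card {x\<in>K. c x \<noteq> 0}" using h(4) by simp
  moreover have "\<bar>\<Sum>x\<in>K. c x * pm (r t) x\<bar> = 1" if t: "t \<in> {2..d}" for t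
  proof -
    have "(\<Sum>x\<in>K. c x * pm (r t) x) = (\<Sum>x\<in>{i, j}. 1 / 2 * pm (r t) x)"
      by (rule sum.mono_neutral_cong_right) (use h assms in \<open>auto simp: c_def\<close>)
    also have "\<dots> = 1 / 2 * pm (r t) i + 1 / 2 * pm (r t) j" using h(4) by simp
    also have "pm (r t) j = pm (r t) i"
      using val_vertex[OF t, of r i] val_vertex[OF t, of r j] h(3) by simp
    finally show ?thesis by (simp add: pm_def)
  qed
  ultimately show False using assms(2) unfolding collapsing_def by blast
qed

lemma isolated_vertex_image:
  assumes "finite K" "\<not> collapsing K {2..d} r"
  shows "isolated d (vertex d r ` K)"
  unfolding isolated_def
proof (intro notI, elim exE conjE)
  fix c :: "(nat \<Rightarrow> nat) \<Rightarrow> real"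
  assume c: "2 \<le> card {\<gamma> \<in> vertex d r ` K. c \<gamma> \<noteq> 0}"
    "\<forall>i\<in>{1..d}. \<bar>\<Sum>\<gamma>\<in>vertex d r ` K. c \<gamma> * val \<gamma> i\<bar> = 1"
  note inj = inj_on_vertex[OF assms]
  have "{\<gamma> \<in> vertex d r ` K. c \<gamma> \<noteq> 0} = vertex d r ` {i\<in>K. c (vertex d r i) \<noteq> 0}" by auto
  also have "card \<dots> = card {i\<in>K. c (vertex d r i) \<noteq> 0}"
    by (rule card_image) (use inj in \<open>auto intro: inj_on_subset\<close>)
  finally have "2 \<le> card {i\<in>K. c (vertex d r i) \<noteq> 0}" using c(1) by simp
  moreover have "\<bar>\<Sum>i\<in>K. c (vertex d r i) * pm (r t) i\<bar> = 1" if t: "t \<in> {2..d}" for t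
  proof -
    have "(\<Sum>\<gamma>\<in>vertex d r ` K. c \<gamma> * val \<gamma> t) = (\<Sum>i\<in>K. c (vertex d r i) * pm (r t) i)"
      by (simp add: sum.reindex[OF inj] val_vertex[OF t])
    moreover have "t \<in> {1..d}" using t by simp
    ultimately show ?thesis using c(2) by metis
  qed
  ultimately have "collapsing K {2..d} r"
    unfolding collapsing_def by (intro exI[of _ "\<lambda>i. c (vertex d r i)"]) blast
  then show False using assms(2) by simp
qed

text \<open>A tuple is determined by the map that lists its vertices, and at most
  \<open>k ^ k\<close> maps list a given set \<open>C\<close>.\<close>

lemma card_not_collapsing_le:
  assumes d: "1 \<le> d"
  shows "card {r \<in> {2..d} \<rightarrow>\<^sub>E Pow {..<k}. \<not> collapsing {..<k} {2..d} r} \<le>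
    card {C. C \<subseteq> facet d \<and> isolated d C} * k ^ k"
proof -
  let ?K = "{..<k}" and ?T = "{2..d}"
  let ?N = "{r \<in> ?T \<rightarrow>\<^sub>E Pow ?K. \<not> collapsing ?K ?T r}"
  let ?G = "{C. C \<subseteq> facet d \<and> isolated d C}"
  have finF: "finite (facet d)" unfolding facet_def using finite_idx by simp
  then have finG: "finite ?G" by simp
  have finN: "finite ?N" using finite_PiE[of ?T "\<lambda>_. Pow ?K"] by simp
  define Fib where "Fib C = {r\<in>?N. vertex d r ` ?K = C}" for C
  have finFib: "finite (Fib C)" for C unfolding Fib_def using finN by (rule finite_subset[rotated]) blast
  have "?N \<subseteq> (\<Union>C\<in>?G. Fib C)"
    using isolated_vertex_image[of ?K d] vertex_in_facet[OF d] by (auto simp: Fib_def)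
  then have "card ?N \<le> card (\<Union>C\<in>?G. Fib C)"
    by (rule card_mono[rotated]) (intro finite_UN_I finG finFib)
  also have "\<dots> \<le> (\<Sum>C\<in>?G. card (Fib C))" by (rule card_UN_le[OF finG])
  also have "\<dots> \<le> (\<Sum>C\<in>?G. k ^ k)"
  proof (rule sum_mono)
    fix C assume C: "C \<in> ?G"
    have finC: "finite C" using C finF by (auto intro: finite_subset)
    show "card (Fib C) \<le> k ^ k"
    proof (cases "Fib C = {}")
      case False
      then obtain r0 where "vertex d r0 ` ?K = C" by (auto simp: Fib_def)
      then have cC: "card C \<le> k" using card_image_le[of ?K "vertex d r0"] by simp
      have "inj_on (\<lambda>r. restrict (vertex d r) ?K) (Fib C)"
      proof (rule inj_onI)
        fix r r' assume r: "r \<in> Fib C" "r' \<in> Fib C"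
          and eq: "restrict (vertex d r) ?K = restrict (vertex d r') ?K"
        have P: "r \<in> ?T \<rightarrow>\<^sub>E Pow ?K" "r' \<in> ?T \<rightarrow>\<^sub>E Pow ?K" using r by (auto simp: Fib_def)
        show "r = r'"
        proof (rule PiE_ext[OF P])
          fix t assume t: "t \<in> ?T"
          have "i \<in> r t \<longleftrightarrow> i \<in> r' t" if "i \<in> ?K" for i
          proof -
            have "vertex d r i = vertex d r' i" using fun_cong[OF eq, of i] that by simp
            then have "pm (r t) i = pm (r' t) i" using val_vertex[OF t, of _ i] by metis
            then show ?thesis by (auto simp: pm_def split: if_splits)
          qed
          moreover have "r t \<subseteq> ?K" "r' t \<subseteq> ?K" using P t by (auto dest!: PiE_mem)
          ultimately show "r t = r' t" by blast
        qed
      qed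
      moreover have "(\<lambda>r. restrict (vertex d r) ?K) ` Fib C \<subseteq> ?K \<rightarrow>\<^sub>E C" by (auto simp: Fib_def)
      ultimately have "card (Fib C) \<le> card (?K \<rightarrow>\<^sub>E C)"
        using finC by (intro card_inj_on_le finite_PiE) auto
      also have "\<dots> = card C ^ k" by (simp add: card_PiE)
      also have "\<dots> \<le> k ^ k" using cC by (rule power_mono) simp
      finally show ?thesis .
    qed simp
  qed
  also have "\<dots> = card ?G * k ^ k" by simp
  finally show ?thesis .
qed

text \<open>The hypothesis \<open>half\<close> says that at most half of the
  \<open>2 ^ (k * (d - 1))\<close> tuples collapse; the others yield isolated sets.\<close>

lemma card_extremal_ge:
  assumes d: "1 \<le> d" and k: "k \<le> d - 1"
    and half: "(\<Sum>j=2..k. real (k choose j) * real (d - 1 choose j) * (2 ^ j * small_ball j ^ (d - 1 - j))) \<le> 1 / 2"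
  shows "2 ^ (k * (d - 1)) / 2 \<le> real (card {A. extremal d A}) * real k ^ k"
proof -
  let ?K = "{..<k}" and ?T = "{2..d}"
  let ?O = "?T \<rightarrow>\<^sub>E Pow ?K"
  let ?B = "{r \<in> ?O. collapsing ?K ?T r}" and ?N = "{r \<in> ?O. \<not> collapsing ?K ?T r}"
  define n where "n = d - 1"
  have cT: "card ?T = n" by (simp add: n_def)
  have finO: "finite ?O" by (intro finite_PiE) auto
  have cO: "card ?O = 2 ^ (k * n)" by (simp add: card_PiE card_Pow power_mult n_def)
  have "real (card ?B) \<le> (\<Sum>j=2..k. real (k choose j) * real (n choose j) *
      ((2 * 2 ^ k) ^ j * (small_ball j * 2 ^ k) ^ (n - j)))"
    using card_collapsing_le[of ?K ?T] k by (simp add: n_def)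
  \<comment> \<open>Each term contains one factor \<open>2 ^ k\<close> per coordinate; without these
    it is the probability bounded in \<open>half\<close>.\<close>
  also have "\<dots> = (\<Sum>j=2..k. 2 ^ (k * n) *
      (real (k choose j) * real (n choose j) * (2 ^ j * small_ball j ^ (n - j))))"
  proof (rule sum.cong)
    fix j assume "j \<in> {2..k}"
    then have "j \<le> n" using k by (simp add: n_def)
    then have "(2::real) ^ (k * n) = (2 ^ k) ^ j * (2 ^ k) ^ (n - j)"
      by (simp add: power_mult power_add[symmetric])
    then show "real (k choose j) * real (n choose j) * ((2 * 2 ^ k) ^ j * (small_ball j * 2 ^ k) ^ (n - j)) =
        2 ^ (k * n) * (real (k choose j) * real (n choose j) * (2 ^ j * small_ball j ^ (n - j)))"
      by (simp only: power_mult_distrib ac_simps)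
  qed simp
  also have "\<dots> \<le> 2 ^ (k * n) * (1 / 2)"
    unfolding sum_distrib_left[symmetric] using half by (intro mult_left_mono) (simp_all add: n_def)
  finally have B: "real (card ?B) \<le> 2 ^ (k * n) / 2" by simp
  have "?O = ?B \<union> ?N" by blast
  then have "card ?O \<le> card ?B + card ?N" using card_Un_le[of ?B ?N] by simp
  then have "real (card ?O) \<le> real (card ?B) + real (card ?N)" by linarith
  then have "2 ^ (k * n) / 2 \<le> real (card ?N)" using B unfolding cO by simp
  also have "card ?N \<le> card {A. extremal d A} * k ^ k"
    using card_not_collapsing_le[OF d, of k] card_isolated_le[OF d]
    by (meson le_trans mult_le_mono1)
  then have "real (card ?N) \<le> real (card {A. extremal d A}) * real k ^ k"
    by (simp only: of_nat_mult[symmetric] of_nat_power[symmetric] of_nat_le_iff)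
  finally show ?thesis by (simp add: n_def)
qed

section \<open>Equivalence classes and the asymptotics\<close>

lemma card_equivalent_class_le: "card (equivalent d `` {A}) \<le> 2 ^ d * fact d"
  and finite_equivalent_class: "finite (equivalent d `` {A})"
proof -
  let ?\<Sigma> = "{1..d} \<rightarrow>\<^sub>E {p. p permutes {0, 1 :: nat}}" and ?\<Pi> = "{\<pi>. \<pi> permutes {1..d}}"
  let ?f = "\<lambda>(\<sigma>, \<pi>). \<lambda>\<alpha>\<in>idx d. A (permute_index d \<sigma> \<pi> \<alpha>)"
  have fin: "finite (?\<Sigma> \<times> ?\<Pi>)"
    by (intro finite_cartesian_product finite_PiE finite_permutations) auto
  have "card ?\<Sigma> = 2 ^ d"
    using card_permutations[of "{0, 1 :: nat}" 2] by (simp add: card_PiE numeral_2_eq_2)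
  moreover have "card ?\<Pi> = fact d" by (rule card_permutations) auto
  ultimately have c: "card (?\<Sigma> \<times> ?\<Pi>) = 2 ^ d * fact d" by (simp only: card_cartesian_product)
  have sub: "equivalent d `` {A} \<subseteq> ?f ` (?\<Sigma> \<times> ?\<Pi>)"
  proof
    fix B assume "B \<in> equivalent d `` {A}"
    then obtain \<sigma> \<pi> where B: "B \<in> matrices d" "\<forall>i\<in>{1..d}. \<sigma> i permutes {0, 1}" "\<pi> permutes {1..d}"
      "\<forall>\<alpha>\<in>idx d. B \<alpha> = A (permute_index d \<sigma> \<pi> \<alpha>)"
      by (auto simp: equivalent_def)
    \<comment> \<open>Only the values of \<open>\<sigma>\<close> on \<open>{1..d}\<close> matter;
      restricting it makes the parameter set finite.\<close>
    have "permute_index d (restrict \<sigma> {1..d}) \<pi> \<alpha> = permute_index d \<sigma> \<pi> \<alpha>" for \<alpha>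
      by (auto simp: permute_index_def)
    moreover have "B \<in> extensional (idx d)" using B(1) by (simp add: matrices_def PiE_def)
    ultimately have "B = ?f (restrict \<sigma> {1..d}, \<pi>)"
      using B(4) by (auto intro!: ext simp: extensional_def)
    then show "B \<in> ?f ` (?\<Sigma> \<times> ?\<Pi>)" by (rule image_eqI) (use B in auto)
  qed
  show "finite (equivalent d `` {A})" using sub fin by (meson finite_imageI finite_subset)
  have "card (equivalent d `` {A}) \<le> card (?f ` (?\<Sigma> \<times> ?\<Pi>))" using sub fin by (intro card_mono) auto
  also have "\<dots> \<le> 2 ^ d * fact d" using card_image_le[OF fin, of ?f] unfolding c .
  finally show "card (equivalent d `` {A}) \<le> 2 ^ d * fact d" .
qed

lemma extremal_quotient: "{A. extremal d A} // equivalent d = (\<lambda>A. equivalent d `` {A}) ` {A. extremal d A}"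
  unfolding quotient_def by blast

lemma num_extremal_le: "num_extremal d \<le> card {A. extremal d A}"
  unfolding num_extremal_def extremal_quotient by (rule card_image_le[OF finite_extremal])

text \<open>By reflexivity the classes cover all extremal matrices, and each class has at most
  \<open>2 ^ d * fact d\<close> members.\<close>

lemma card_extremal_le_num_extremal:
  "card {A. extremal d A} \<le> num_extremal d * (2 ^ d * fact d)"
proof -
  let ?Q = "{A. extremal d A} // equivalent d"
  have finQ: "finite ?Q" unfolding extremal_quotient using finite_extremal by (rule finite_imageI)
  have "A \<in> equivalent d `` {A}" if "extremal d A" for A
  proof -
    have "permute_index d (\<lambda>_. id) id \<alpha> = \<alpha>" if "\<alpha> \<in> idx d" for \<alpha>
      using that by (auto simp: permute_index_def idx_def PiE_def extensional_def fun_eq_iff)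
    then have "(A, A) \<in> equivalent d"
      using that unfolding equivalent_def extremal_def
      by (auto intro!: exI[of _ "\<lambda>_. id"] exI[of _ id] simp: permutes_id)
    then show ?thesis by blast
  qed
  then have "{A. extremal d A} \<subseteq> (\<Union>c\<in>?Q. c)" unfolding extremal_quotient by blast
  moreover have "finite (\<Union>c\<in>?Q. c)"
    using finQ finite_equivalent_class unfolding extremal_quotient by blast
  ultimately have "card {A. extremal d A} \<le> card (\<Union>c\<in>?Q. c)" by (intro card_mono)
  also have "\<dots> \<le> (\<Sum>c\<in>?Q. card c)" by (rule card_UN_le[OF finQ])
  also have "\<dots> \<le> (\<Sum>c\<in>?Q. 2 ^ d * fact d)"
    by (rule sum_mono) (auto simp: extremal_quotient card_equivalent_class_le)
  finally show ?thesis by (simp add: num_extremal_def)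
qed

lemma num_extremal_pos: "1 \<le> d \<Longrightarrow> 0 < num_extremal d"
proof -
  assume d: "1 \<le> d"
  \<comment> \<open>With \<open>k = 0\<close> the sum in the hypothesis is empty and the bound reads
    \<open>1 / 2 \<le> card {A. extremal d A}\<close>.\<close>
  have "0 < real (card {A. extremal d A})" using card_extremal_ge[OF d, of 0] by simp
  then show ?thesis using card_extremal_le_num_extremal[of d] by (cases "num_extremal d = 0") auto
qed

section \<open>Logarithmic estimates and the limit\<close>

lemma log_num_extremal_le:
  assumes d: "1 \<le> d"
  shows "log 2 (real (num_extremal d)) \<le> real d * (real d + 1)"
proof -
  have "num_extremal d \<le> (2 ^ d + 1) ^ d"
    using num_extremal_le card_extremal_le[OF d] by (rule le_trans)
  also have "\<dots> \<le> (2 ^ (d + 1)) ^ d" by (rule power_mono) auto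
  also have "\<dots> = 2 ^ (d * (d + 1))" by (simp only: power_mult[symmetric] mult.commute)
  finally have "real (num_extremal d) \<le> 2 ^ (d * (d + 1))"
    by (metis of_nat_le_iff of_nat_numeral of_nat_power)
  then have "log 2 (real (num_extremal d)) \<le> log 2 (2 ^ (d * (d + 1)))"
    using num_extremal_pos[OF d] by (intro log_mono) auto
  also have "\<dots> = real d * (real d + 1)" by (simp add: log_nat_power algebra_simps)
  finally show ?thesis .
qed

text \<open>Both \<open>k ^ k\<close> and \<open>fact d\<close> are at most \<open>d ^ d\<close>,
  which accounts for \<open>2 * d * log 2 d\<close>; the orientations cost \<open>d\<close> and the
  factor one half costs 1.\<close>

lemma log_num_extremal_ge:
  assumes d: "1 \<le> d" and k: "k \<le> d - 1"
    and half: "(\<Sum>j=2..k. real (k choose j) * real (d - 1 choose j) * (2 ^ j * small_ball j ^ (d - 1 - j))) \<le> 1 / 2"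
  shows "real k * (real d - 1) - 1 - real d - 2 * real d * log 2 (real d) \<le> log 2 (real (num_extremal d))"
proof -
  define M where "M = real (num_extremal d)"
  have M: "0 < M" using num_extremal_pos[OF d] by (simp add: M_def)
  have "real k ^ k \<le> real d ^ k" using k by (intro power_mono) auto
  also have "\<dots> \<le> real d ^ d" using k d by (intro power_increasing) auto
  finally have kk: "real k ^ k \<le> real d ^ d" .
  have "fact d \<le> real d ^ d" using fact_le_power[of d, where 'a = real] by simp
  then have E: "real (card {A. extremal d A}) \<le> M * (2 ^ d * real d ^ d)"
  proof -
    have "real (card {A. extremal d A}) \<le> real (num_extremal d * (2 ^ d * fact d))"
      using card_extremal_le_num_extremal by (simp only: of_nat_le_iff)
    also have "\<dots> = M * (2 ^ d * fact d)" by (simp add: M_def)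
    also have "\<dots> \<le> M * (2 ^ d * real d ^ d)"
      using \<open>fact d \<le> real d ^ d\<close> M by (intro mult_left_mono) auto
    finally show ?thesis .
  qed
  have "2 ^ (k * (d - 1)) / 2 \<le> real (card {A. extremal d A}) * real k ^ k"
    by (rule card_extremal_ge[OF d k half])
  also have "\<dots> \<le> (M * (2 ^ d * real d ^ d)) * real d ^ d"
    using M by (intro mult_mono E kk) auto
  finally have "2 ^ (k * (d - 1)) / 2 \<le> M * (2 ^ d * real d ^ d) * real d ^ d" .
  then have "log 2 (2 ^ (k * (d - 1)) / 2) \<le> log 2 (M * (2 ^ d * real d ^ d) * real d ^ d)"
    by (intro log_mono) auto
  also have "log 2 (2 ^ (k * (d - 1)) / 2) = real k * (real d - 1) - 1"
    using d by (simp add: log_divide log_nat_power of_nat_diff)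
  also have "log 2 (M * (2 ^ d * real d ^ d) * real d ^ d) = log 2 M + real d + 2 * real d * log 2 (real d)"
    using M d by (simp add: log_mult log_nat_power)
  finally show ?thesis by (simp add: M_def)
qed

lemma eventually_log_num_extremal_ge:
  fixes \<delta> :: real
  assumes "0 < \<delta>" "\<delta> < 1"
  shows "\<forall>\<^sub>F d in sequentially.
    ((1 - \<delta>) * (real d - 1) - 1) * (real d - 1) - 1 - real d - 2 * real d * log 2 (real d)
      \<le> log 2 (real (num_extremal d))"
proof -
  obtain N where N: "\<And>n k. N \<le> n \<Longrightarrow> real k \<le> (1 - \<delta>) * real n \<Longrightarrow>
      (\<Sum>j=2..k. real (k choose j) * real (n choose j) * (2 ^ j * small_ball j ^ (n - j))) \<le> 1 / 2"
    using eventually_collapse_sum_le_half[OF assms] unfolding eventually_sequentially by blast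
  show ?thesis
    using eventually_ge_at_top[of "N + 1"]
  proof eventually_elim
    case (elim d)
    then have d: "1 \<le> d" "N \<le> d - 1" by auto
    \<comment> \<open>The largest admissible number of vertices; rounding loses at most 1, the inner
      \<open>- 1\<close> of the claimed bound.\<close>
    define k where "k = nat \<lfloor>(1 - \<delta>) * real (d - 1)\<rfloor>"
    have nn: "0 \<le> (1 - \<delta>) * real (d - 1)" using assms by simp
    have k1: "real k \<le> (1 - \<delta>) * real (d - 1)" and k2: "(1 - \<delta>) * real (d - 1) - 1 \<le> real k"
      unfolding k_def using nn by linarith+
    have "(1 - \<delta>) * real (d - 1) \<le> 1 * real (d - 1)" using assms by (intro mult_right_mono) auto
    then have "k \<le> d - 1" using k1 by linarith
    then have "real k * (real d - 1) - 1 - real d - 2 * real d * log 2 (real d) \<le> log 2 (real (num_extremal d))"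
      by (rule log_num_extremal_ge[OF d(1) _ N[OF d(2) k1]])
    moreover have "((1 - \<delta>) * (real d - 1) - 1) * (real d - 1) \<le> real k * (real d - 1)"
      using k2 d(1) by (intro mult_right_mono) (auto simp: of_nat_diff)
    ultimately show ?case by linarith
  qed
qed

lemma log_num_extremal_over_square_tendsto_1:
  "(\<lambda>d. log 2 (real (num_extremal d)) / (real d)\<^sup>2) \<longlonglongrightarrow> 1"
proof (rule order_tendstoI)
  fix y :: real assume y: "1 < y"
  have "(\<lambda>d. (real d * (real d + 1)) / (real d)\<^sup>2) \<longlonglongrightarrow> 1" by real_asymp
  then have "\<forall>\<^sub>F d in sequentially. (real d * (real d + 1)) / (real d)\<^sup>2 < y"
    using y by (rule order_tendstoD)
  then show "\<forall>\<^sub>F d in sequentially. log 2 (real (num_extremal d)) / (real d)\<^sup>2 < y"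
    using eventually_ge_at_top[of 1]
  proof eventually_elim
    case (elim d)
    have "log 2 (real (num_extremal d)) / (real d)\<^sup>2 \<le> (real d * (real d + 1)) / (real d)\<^sup>2"
      using log_num_extremal_le elim(2) by (intro divide_right_mono) auto
    then show ?case using elim(1) by linarith
  qed
next
  fix y :: real assume y: "y < 1"
  \<comment> \<open>Half the distance from \<open>y\<close> to 1 keeps
    \<open>y < 1 - \<delta>\<close>; the cap \<open>1 / 2\<close> keeps \<open>\<delta>\<close>
    below 1 when \<open>y\<close> is very small.\<close>
  define \<delta> where "\<delta> = min (1 / 2) ((1 - y) / 2)"
  have \<delta>: "0 < \<delta>" "\<delta> < 1" "y < 1 - \<delta>" using y by (auto simp: \<delta>_def min_def field_simps)
  let ?g = "\<lambda>d. ((1 - \<delta>) * (real d - 1) - 1) * (real d - 1) - 1 - real d - 2 * real d * log 2 (real d)"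
  \<comment> \<open>In \<open>?g\<close> the rounding loss \<open>- (d - 1)\<close>, the constant
    \<open>- 1\<close> and \<open>- d\<close> add up to \<open>- 2 * d\<close>.\<close>
  have "(\<lambda>d. (1 - \<delta>) * ((real d - 1)\<^sup>2 / (real d)\<^sup>2) -
      (2 * real d + 2 * real d * log 2 (real d)) / (real d)\<^sup>2) \<longlonglongrightarrow> (1 - \<delta>) * 1 - 0"
    by (intro tendsto_diff tendsto_mult tendsto_const; real_asymp)
  also have "(\<lambda>d. (1 - \<delta>) * ((real d - 1)\<^sup>2 / (real d)\<^sup>2) -
      (2 * real d + 2 * real d * log 2 (real d)) / (real d)\<^sup>2) = (\<lambda>d. ?g d / (real d)\<^sup>2)"
    unfolding times_divide_eq_right diff_divide_distrib[symmetric]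
    by (rule ext) (simp add: power2_eq_square algebra_simps)
  finally have "(\<lambda>d. ?g d / (real d)\<^sup>2) \<longlonglongrightarrow> 1 - \<delta>" by simp
  then have "\<forall>\<^sub>F d in sequentially. y < ?g d / (real d)\<^sup>2" using \<delta>(3) by (rule order_tendstoD)
  then show "\<forall>\<^sub>F d in sequentially. y < log 2 (real (num_extremal d)) / (real d)\<^sup>2"
    using eventually_log_num_extremal_ge[OF \<delta>(1,2)]
  proof eventually_elim
    case (elim d)
    have "?g d / (real d)\<^sup>2 \<le> log 2 (real (num_extremal d)) / (real d)\<^sup>2"
      using elim(2) by (intro divide_right_mono) auto
    then show ?case using elim(1) by linarith
  qed
qed

theorem theorem13:
  "\<exists>\<epsilon> :: nat \<Rightarrow> real. \<epsilon> \<in> o[at_top](\<lambda>_. 1) \<and>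
     (\<forall>\<^sub>F d in at_top. log 2 (real (num_extremal d)) = (real d)\<^sup>2 * (1 + \<epsilon> d))"
proof (intro exI conjI)
  let ?\<epsilon> = "\<lambda>d. log 2 (real (num_extremal d)) / (real d)\<^sup>2 - 1"
  have "?\<epsilon> \<longlonglongrightarrow> 1 - 1" by (intro tendsto_diff log_num_extremal_over_square_tendsto_1 tendsto_const)
  then show "?\<epsilon> \<in> o[at_top](\<lambda>_. 1)" by (intro smalloI_tendsto) simp_all
  show "\<forall>\<^sub>F d in at_top. log 2 (real (num_extremal d)) = (real d)\<^sup>2 * (1 + ?\<epsilon> d)"
    using eventually_ge_at_top[of 1] by eventually_elim simp
qed

end
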